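(* Let $T$ be a unitary operator on a complex Hilbert space $\mathcal{H}$, let $\psi\in\mathcal{H}\setminus\{0\}$, set $\psi_k=T^k\psi$ ($k\in\mathbb{Z}$), and let $\mathcal{H}(\psi)$ be the closed linear span of $\{\psi_k:k\in\mathbb{Z}\}$. Then: (1) If $\{\psi_k\}$ is a Bessel sequence in $\mathcal{H}(\psi)$, i.e. there is $B\in\mathbb{R}_+$ with $\sum_{k\in\mathbb{Z}}|\langle\psi_k\mid f\rangle|^2\le B\|f\|^2$ for all $f\in\mathcal{H}(\psi)$, then $\mu_\psi$ is absolutely continuous with respect to Lebesgue measure on $[0,1]$, i.e. $d\mu_\psi(x)=p_\psi(x)\,dx$ with $p_\psi\in L^1(0,1)$. (2) If $\mu_\psi$ is absolutely continuous with Radon–Nikodym derivative $p_\psi$, then there exist a vector $\psi_{\mathrm{REN}}\in\mathcal{H}$ and a Borel set $A\subset[0,1]$ such that (a) $\mathcal{H}(\psi)=\mathcal{H}(\psi_{\mathrm{REN}})$, (b) $d\mu_{\psi_{\mathrm{REN}}}(x)=\chi_A(x)\,dx$, and (c) $A$ is the essential support of $p_\psi$.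
   Context: For a unitary $T$, $E$ denotes its projection-valued spectral measure on the Borel sets of $[0,1)\simeq\mathbb{T}$ (via $x\mapsto e^{i2\pi x}$), so $T^k=\int_0^1e^{i2\pi kx}E(dx)$; the spectral measure of a vector $\varphi$ is $\mu_\varphi(A)=\langle\varphi\mid E(A)\varphi\rangle$, and $\mathcal{H}(\varphi)$ is the closed span of $\{T^k\varphi\}_{k\in\mathbb{Z}}$. Inner products are conjugate-linear in the first variable. *)

theory Defs
  imports "HOL-Analysis.Analysis"
begin

class complex_vector = real_vector +
  fixes scaleC :: "complex \<Rightarrow> 'a \<Rightarrow> 'a"
  assumes scaleC_add_right: "scaleC a (x + y) = scaleC a x + scaleC a y"
    and scaleC_add_left: "scaleC (a + b) x = scaleC a x + scaleC b x"
    and scaleC_scaleC: "scaleC a (scaleC b x) = scaleC (a * b) x"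
    and scaleC_one: "scaleC 1 x = x"
    and scaleR_scaleC: "scaleR r x = scaleC (complex_of_real r) x"

class complex_inner = complex_vector + real_normed_vector +
  fixes cinner :: "'a \<Rightarrow> 'a \<Rightarrow> complex"
  assumes cinner_commute: "cinner x y = cnj (cinner y x)"
    and cinner_add_left: "cinner (x + y) z = cinner x z + cinner y z"
    and cinner_scaleC_left: "cinner (scaleC r x) y = cnj r * cinner x y"
    and cinner_self_real: "Im (cinner x x) = 0"
    and cinner_self_nonneg: "0 \<le> Re (cinner x x)"
    and cinner_self_eq_zero: "cinner x x = 0 \<longleftrightarrow> x = 0"
    and norm_eq_sqrt_cinner: "norm x = sqrt (Re (cinner x x))"

class chilbert_space = complex_inner + complete_space

definition unitary :: "('a::complex_inner \<Rightarrow> 'a) \<Rightarrow> bool" where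
  "unitary T \<longleftrightarrow>
     (\<forall>x y. T (x + y) = T x + T y) \<and>
     (\<forall>c x. T (scaleC c x) = scaleC c (T x)) \<and>
     (\<forall>x y. cinner (T x) (T y) = cinner x y) \<and>
     surj T"

definition upow :: "('a \<Rightarrow> 'a) \<Rightarrow> int \<Rightarrow> 'a \<Rightarrow> 'a" where
  "upow T k = (if 0 \<le> k then T ^^ nat k else inv T ^^ nat (- k))"

definition cspan :: "'a::complex_vector set \<Rightarrow> 'a set" where
  "cspan S = {y. \<exists>F c. finite F \<and> F \<subseteq> S \<and> y = (\<Sum>x\<in>F. scaleC (c x) x)}"

definition cyclic_subspace :: "('a::complex_inner \<Rightarrow> 'a) \<Rightarrow> 'a \<Rightarrow> 'a set" where
  "cyclic_subspace T \<phi> = closure (cspan (range (\<lambda>k. upow T k \<phi>)))"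

text \<open>Lebesgue measure on \<open>[0,1) \<simeq> \<TT>\<close> (Borel sets).\<close>
definition lebesgue_01 :: "real measure" where
  "lebesgue_01 = restrict_space lborel {0..<1}"

text \<open>\<open>\<mu>\<close> is the spectral measure of \<open>\<phi>\<close> w.r.t. the unitary \<open>T\<close>: a finite Borel measure
  on \<open>[0,1)\<close> with \<open>\<langle>\<phi> | T^k \<phi>\<rangle> = \<integral> e^{i2\<pi>kx} d\<mu>(x)\<close> for all \<open>k \<in> \<int>\<close>
  (i.e. \<open>\<mu>(A) = \<langle>\<phi> | E(A) \<phi>\<rangle>\<close>, which is uniquely determined by these moments).\<close>
definition is_spectral_measure ::
  "('a::complex_inner \<Rightarrow> 'a) \<Rightarrow> 'a \<Rightarrow> real measure \<Rightarrow> bool" where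
  "is_spectral_measure T \<phi> \<mu> \<longleftrightarrow>
     sets \<mu> = sets lebesgue_01 \<and> finite_measure \<mu> \<and>
     (\<forall>k::int. cinner \<phi> (upow T k \<phi>) =
        (LINT x|\<mu>. cis (2 * pi * real_of_int k * x)))"

end

theory Submission
  imports Defs
begin

text \<open>
  The map \<open>P \<mapsto> P(T)\<psi>\<close> on trigonometric polynomials is isometric from \<open>L\<^sup>2(\<mu>\<^sub>\<psi>)\<close>, and trigonometric
  polynomials are dense in \<open>L\<^sup>2\<close> of every finite Borel measure on \<open>[0,1)\<close>.

  For (1), the Bessel bound dualises to \<open>\<parallel>\<Sum> c\<^sub>k \<psi>\<^sub>k\<parallel>\<^sup>2 \<le> B \<Sum> \<bar>c\<^sub>k\<bar>\<^sup>2\<close>, that is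
  \<open>\<integral> \<bar>P\<bar>\<^sup>2 d\<mu>\<^sub>\<psi> \<le> B \<integral> \<bar>P\<bar>\<^sup>2 dx\<close>. Approximating the indicator of a Lebesgue null set
  in \<open>L\<^sup>2(\<mu>\<^sub>\<psi> + dx)\<close> shows that the set is \<open>\<mu>\<^sub>\<psi>\<close>-null.

  For (2), let \<open>A = {p > 0}\<close> and \<open>f = \<chi>\<^sub>A / \<surd>p \<in> L\<^sup>2(\<mu>\<^sub>\<psi>)\<close>. If \<open>P\<^sub>n \<rightarrow> f\<close> in \<open>L\<^sup>2(\<mu>\<^sub>\<psi>)\<close>, then
  \<open>P\<^sub>n(T)\<psi>\<close> converges to a vector with spectral measure \<open>\<bar>f\<bar>\<^sup>2 p dx = \<chi>\<^sub>A dx\<close>; approximating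
  \<open>\<surd>p\<close> in \<open>L\<^sup>2(\<chi>\<^sub>A dx)\<close> recovers \<open>\<psi>\<close> from it.
\<close>

section \<open>Complex inner product spaces and unitary operators\<close>

lemma scaleC_zero_right [simp]: "scaleC c (0::'a::complex_vector) = 0"
  using scaleC_add_right[of c 0 "0::'a"] by simp

lemma scaleC_zero_left [simp]: "scaleC 0 (x::'a::complex_vector) = 0"
  using scaleC_add_left[of 0 0 x] by simp

lemma scaleC_minus_one: "scaleC (- 1) x = - (x::'a::complex_vector)"
  using scaleR_scaleC[of "-1" x] by simp

lemma scaleC_sum_left: "scaleC (sum c F) x = (\<Sum>k\<in>F. scaleC (c k) (x::'a::complex_vector))"
  by (induction F rule: infinite_finite_induct) (auto simp: scaleC_add_left)

lemma scaleC_sum_right: "scaleC a (sum f F) = (\<Sum>k\<in>F. scaleC a (f k :: 'a::complex_vector))"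
  by (induction F rule: infinite_finite_induct) (auto simp: scaleC_add_right)


lemma cinner_add_right: "cinner (x::'a::complex_inner) (y + z) = cinner x y + cinner x z"
  by (metis cinner_add_left cinner_commute complex_cnj_add)

lemma cinner_scaleC_right: "cinner (x::'a::complex_inner) (scaleC r y) = r * cinner x y"
  by (metis cinner_commute cinner_scaleC_left complex_cnj_cnj complex_cnj_mult)

lemma cinner_zero_left [simp]: "cinner 0 (x::'a::complex_inner) = 0"
  using cinner_add_left[of 0 "0::'a" x] by simp

lemma cinner_zero_right [simp]: "cinner (x::'a::complex_inner) 0 = 0"
  using cinner_add_right[of x 0 "0::'a"] by simp

lemma cinner_minus_left: "cinner (- x) (y::'a::complex_inner) = - cinner x y"
  using cinner_add_left[of x "- x" y] by (simp add: add_eq_0_iff)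

lemma cinner_minus_right: "cinner (x::'a::complex_inner) (- y) = - cinner x y"
  using cinner_add_right[of x y "- y"] by (simp add: add_eq_0_iff)

lemma cinner_diff_left: "cinner (x - y) (z::'a::complex_inner) = cinner x z - cinner y z"
  using cinner_add_left[of x "- y" z] by (simp add: cinner_minus_left)

lemma cinner_diff_right: "cinner (x::'a::complex_inner) (y - z) = cinner x y - cinner x z"
  using cinner_add_right[of x y "- z"] by (simp add: cinner_minus_right)

lemma cinner_sum_left: "cinner (sum f F) (x::'a::complex_inner) = (\<Sum>k\<in>F. cinner (f k) x)"
  by (induction F rule: infinite_finite_induct) (auto simp: cinner_add_left)

lemma cinner_sum_right: "cinner (x::'a::complex_inner) (sum f F) = (\<Sum>k\<in>F. cinner x (f k))"
  by (induction F rule: infinite_finite_induct) (auto simp: cinner_add_right)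

lemma cinner_self: "cinner x (x::'a::complex_inner) = complex_of_real ((norm x)\<^sup>2)"
  using cinner_self_real[of x] cinner_self_nonneg[of x]
  by (simp add: norm_eq_sqrt_cinner complex_eq_iff)

text \<open>The norm meets non-real scalars only through \<open>cinner\<close>, so squared norms are
  compared and the root is taken at the end.\<close>

lemma norm_scaleC: "norm (scaleC c (x::'a::complex_inner)) = cmod c * norm x"
proof -
  have "complex_of_real ((norm (scaleC c x))\<^sup>2) = complex_of_real ((cmod c * norm x)\<^sup>2)"
    unfolding cinner_self[symmetric] cinner_scaleC_left cinner_scaleC_right
    by (simp add: cinner_self power_mult_distrib complex_norm_square[symmetric] mult.commute flip: mult.assoc)
  then have "(norm (scaleC c x))\<^sup>2 = (cmod c * norm x)\<^sup>2"
    by (simp only: of_real_eq_iff)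
  then show ?thesis
    by (subst (asm) power2_eq_iff_nonneg) (auto simp: norm_eq_sqrt_cinner cinner_self_nonneg)
qed

text \<open>What remains of \<open>x\<close> after orthogonal projection onto the line through
  \<open>y\<close> has nonnegative squared norm; \<open>t\<close> is the coefficient of that
  projection.\<close>

lemma Cauchy_Schwarz_cinner: "cmod (cinner x (y::'a::complex_inner)) \<le> norm x * norm y"
proof (cases "y = 0")
  case False
  define t where "t = cinner y x / cinner y y"
  have n0: "norm y \<noteq> 0"
    using False cinner_self[of y] cinner_self_eq_zero[of y] by auto
  have "cinner (x - scaleC t y) (x - scaleC t y)
      = cinner x x - t * cinner x y - cnj t * cinner y x + cnj t * t * cinner y y"
    by (simp add: cinner_diff_left cinner_diff_right cinner_scaleC_left cinner_scaleC_right algebra_simps)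
  also have "\<dots> = cinner x x - cinner y x * cinner x y / cinner y y"
    using n0 by (simp add: t_def cinner_self power2_eq_square)
  also have "cinner y x * cinner x y = complex_of_real ((cmod (cinner x y))\<^sup>2)"
    by (subst (1) cinner_commute) (simp add: complex_norm_square mult.commute del: of_real_power)
  finally have "complex_of_real ((norm (x - scaleC t y))\<^sup>2)
      = complex_of_real ((norm x)\<^sup>2 - (cmod (cinner x y))\<^sup>2 / (norm y)\<^sup>2)"
    by (simp add: cinner_self)
  then have "(norm (x - scaleC t y))\<^sup>2 = (norm x)\<^sup>2 - (cmod (cinner x y))\<^sup>2 / (norm y)\<^sup>2"
    by (simp only: of_real_eq_iff)
  then have "(cmod (cinner x y))\<^sup>2 / (norm y)\<^sup>2 \<le> (norm x)\<^sup>2"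
    by (metis diff_ge_0_iff_ge zero_le_power2)
  then have "(cmod (cinner x y))\<^sup>2 \<le> (norm x * norm y)\<^sup>2"
    using n0 by (simp add: field_simps)
  then show ?thesis
    by (rule power2_le_imp_le) (simp add: norm_eq_sqrt_cinner cinner_self_nonneg)
qed simp

text \<open>Over the reals, conjugate-linearity in the first argument is ordinary linearity, so the
  theory of bounded bilinear maps supplies the limit rules for \<open>cinner\<close>.\<close>

lemma bounded_bilinear_cinner: "bounded_bilinear (cinner :: 'a::complex_inner \<Rightarrow> 'a \<Rightarrow> complex)"
proof
  show "\<exists>K. \<forall>a b::'a. norm (cinner a b) \<le> norm a * norm b * K"
    by (rule exI[of _ 1]) (auto simp: Cauchy_Schwarz_cinner)
qed (auto simp: cinner_add_left cinner_add_right scaleR_scaleC cinner_scaleC_left cinner_scaleC_right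
    scaleR_conv_of_real)

lemma tendsto_cinner:
  "(f \<longlongrightarrow> a) F \<Longrightarrow> (g \<longlongrightarrow> b) F \<Longrightarrow> ((\<lambda>x. cinner (f x) (g x :: 'a::complex_inner)) \<longlongrightarrow> cinner a b) F"
  by (rule bounded_bilinear.tendsto[OF bounded_bilinear_cinner])

lemma tendsto_scaleC:
  assumes "(f \<longlongrightarrow> (a::'a::complex_inner)) F"
  shows "((\<lambda>x. scaleC c (f x)) \<longlongrightarrow> scaleC c a) F"
proof -
  have "bounded_linear (scaleC c :: 'a \<Rightarrow> 'a)"
    by (rule bounded_linear_intro[where K = "cmod c"])
      (auto simp: scaleC_add_right scaleR_scaleC scaleC_scaleC norm_scaleC mult.commute)
  then show ?thesis
    using assms by (rule bounded_linear.tendsto)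
qed

section \<open>Unitary operators and their integer powers\<close>

lemma unitary_bij:
  assumes "unitary (T :: 'a::complex_inner \<Rightarrow> 'a)"
  shows "bij T"
proof -
  have add: "T (x + y) = T x + T y" and inner: "cinner (T x) (T y) = cinner x y" for x y
    using assms by (auto simp: unitary_def)
  have "inj T"
  proof (rule injI)
    fix x y assume "T x = T y"
    then have "T (x - y) = 0"
      using add[of "x - y" y] by simp
    then have "cinner (x - y) (x - y) = 0"
      using inner[of "x - y" "x - y"] by simp
    then show "x = y"
      by (simp add: cinner_self_eq_zero)
  qed
  then show ?thesis
    using assms by (simp add: bij_def unitary_def)
qed

lemma upow_0 [simp]: "upow T 0 x = x"
  by (simp add: upow_def)

lemma upow_succ:
  assumes "bij T"
  shows "upow T (k + 1) x = T (upow T k x)"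
proof (cases "0 \<le> k")
  case True
  then show ?thesis
    by (simp add: upow_def nat_add_distrib)
next
  case False
  then have "nat (- k) = Suc (nat (- (k + 1)))"
    by simp
  then show ?thesis
    using False assms
    \<comment> \<open>At \<open>k = - 1\<close> the exponent \<open>k + 1 = 0\<close> already
      belongs to the other branch of \<open>upow\<close>.\<close>
    by (cases "k = - 1") (auto simp: upow_def surj_f_inv_f bij_is_surj)
qed

lemma upow_pred:
  assumes "bij T"
  shows "upow T (k - 1) x = inv T (upow T k x)"
  using upow_succ[OF assms, of "k - 1" x] assms by (simp add: inv_f_f bij_is_inj)

lemma upow_add:
  assumes "bij T"
  shows "upow T (j + k) x = upow T j (upow T k x)"
proof (induction j rule: int_induct[where k = 0])
  case (step1 i)
  then show ?case
    using upow_succ[OF assms, of "i + k" x] upow_succ[OF assms, of i]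
    by (simp add: ac_simps)
next
  case (step2 i)
  then show ?case
    using upow_pred[OF assms, of "i + k" x] upow_pred[OF assms, of i]
    by (simp add: algebra_simps)
qed simp

lemma unitary_inv:
  assumes "unitary (T :: 'a::complex_inner \<Rightarrow> 'a)"
  shows "unitary (inv T)"
proof -
  have b: "bij T"
    by (rule unitary_bij[OF assms])
  have [simp]: "T (inv T x) = x" "inv T (T x) = x" for x
    using b by (auto simp: surj_f_inv_f inv_f_f bij_is_surj bij_is_inj)
  have add: "T (x + y) = T x + T y" and inner: "cinner (T x) (T y) = cinner x y"
    and scale: "T (scaleC c x) = scaleC c (T x)" for x y c
    using assms by (auto simp: unitary_def)
  have "inv T (x + y) = inv T x + inv T y" for x y
    using add[of "inv T x" "inv T y"] by (metis \<open>\<And>x. T (inv T x) = x\<close> \<open>\<And>x. inv T (T x) = x\<close>)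
  moreover have "inv T (scaleC c x) = scaleC c (inv T x)" for c x
    using scale[of c "inv T x"] by (metis \<open>\<And>x. T (inv T x) = x\<close> \<open>\<And>x. inv T (T x) = x\<close>)
  moreover have "cinner (inv T x) (inv T y) = cinner x y" for x y
    using inner[of "inv T x" "inv T y"] by simp
  moreover have "surj (inv T)"
    by (rule surjI[of _ T]) simp
  ultimately show ?thesis
    by (simp add: unitary_def)
qed

lemma unitary_funpow:
  assumes "unitary (T :: 'a::complex_inner \<Rightarrow> 'a)"
  shows "unitary (T ^^ n)"
proof (induction n)
  case 0
  then show ?case by (simp add: unitary_def)
next
  case (Suc n)
  have "surj (T ^^ Suc n)"
    unfolding funpow.simps using Suc assms by (intro comp_surj) (auto simp: unitary_def)
  with Suc assms show ?case
    by (simp add: unitary_def)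
qed

lemma unitary_upow:
  assumes "unitary (T :: 'a::complex_inner \<Rightarrow> 'a)"
  shows "unitary (upow T k)"
  using unitary_funpow[OF assms] unitary_funpow[OF unitary_inv[OF assms]]
  by (simp add: upow_def)

lemma unitary_norm:
  assumes "unitary (T :: 'a::complex_inner \<Rightarrow> 'a)"
  shows "norm (T x) = norm x"
  using assms by (simp add: unitary_def norm_eq_sqrt_cinner)

lemma unitary_tendsto:
  assumes "unitary (T :: 'a::complex_inner \<Rightarrow> 'a)" "(f \<longlongrightarrow> a) F"
  shows "((\<lambda>x. T (f x)) \<longlongrightarrow> T a) F"
proof -
  have "bounded_linear T"
    by (rule bounded_linear_intro[where K = 1])
      (use assms unitary_norm[OF assms(1)] in \<open>auto simp: unitary_def scaleR_scaleC\<close>)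
  then show ?thesis
    using assms(2) by (rule bounded_linear.tendsto)
qed

text \<open>The orbit is stationary: for \<open>x = y\<close> its Gram matrix depends on
  \<open>k - j\<close> alone. Hence the moments in \<open>is_spectral_measure\<close> determine
  every inner product between vectors in the span of the orbit.\<close>

lemma cinner_upow_upow:
  assumes "unitary (T :: 'a::complex_inner \<Rightarrow> 'a)"
  shows "cinner (upow T j x) (upow T k y) = cinner x (upow T (k - j) y)"
proof -
  have "upow T k y = upow T j (upow T (k - j) y)"
    using upow_add[OF unitary_bij[OF assms], of j "k - j" y] by simp
  then show ?thesis
    using unitary_upow[OF assms, of j] by (simp add: unitary_def)
qed

section \<open>Density of trigonometric polynomials\<close>

definition trig :: "(int \<Rightarrow> complex) \<Rightarrow> int set \<Rightarrow> real \<Rightarrow> complex" where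
  "trig c F x = (\<Sum>k\<in>F. c k * cis (2 * pi * real_of_int k * x))"

definition trig_polys :: "(real \<Rightarrow> complex) set" where
  "trig_polys = {P. \<exists>c F. finite F \<and> P = trig c F}"

text \<open>Padding with zero coefficients moves two polynomials to a common index set, where they
  can be added coefficientwise.\<close>

lemma trig_extend:
  assumes "finite G" "F \<subseteq> G"
  shows "trig c F = trig (\<lambda>k. if k \<in> F then c k else 0) G"
  unfolding trig_def by (rule ext, rule sum.mono_neutral_cong_left) (use assms in auto)

lemma trig_in_trig_polys: "finite F \<Longrightarrow> trig c F \<in> trig_polys"
  by (auto simp: trig_polys_def)

lemma trig_polys_cis: "(\<lambda>x. c * cis (2 * pi * real_of_int k * x)) \<in> trig_polys"
  using trig_in_trig_polys[of "{k}" "\<lambda>_. c"] by (simp add: trig_def[abs_def])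

lemma trig_polys_const: "(\<lambda>x. c) \<in> trig_polys"
  using trig_polys_cis[of c 0] by simp

lemma trig_polys_add:
  assumes "P \<in> trig_polys" "Q \<in> trig_polys"
  shows "(\<lambda>x. P x + Q x) \<in> trig_polys"
proof -
  obtain c F d G where *: "finite F" "P = trig c F" "finite G" "Q = trig d G"
    using assms by (auto simp: trig_polys_def)
  let ?c = "\<lambda>k. if k \<in> F then c k else 0" and ?d = "\<lambda>k. if k \<in> G then d k else 0"
  have "P = trig ?c (F \<union> G)" "Q = trig ?d (F \<union> G)"
    unfolding * by (rule trig_extend; use * in simp)+
  then have "(\<lambda>x. P x + Q x) = trig (\<lambda>k. ?c k + ?d k) (F \<union> G)"
    by (intro ext) (simp only: trig_def sum.distrib distrib_right)
  then show ?thesis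
    using * by (simp add: trig_in_trig_polys)
qed

lemma trig_polys_sum:
  "(\<And>i. i \<in> I \<Longrightarrow> P i \<in> trig_polys) \<Longrightarrow> (\<lambda>x. \<Sum>i\<in>I. P i x) \<in> trig_polys"
proof (induction I rule: infinite_finite_induct)
  case (insert i I)
  show ?case
    unfolding sum.insert[OF insert(1,2)] by (intro trig_polys_add insert.IH) (use insert.prems in auto)
qed (simp_all add: trig_polys_const)

lemma trig_polys_mult:
  assumes "P \<in> trig_polys" "Q \<in> trig_polys"
  shows "(\<lambda>x. P x * Q x) \<in> trig_polys"
proof -
  obtain c F d G where *: "finite F" "P = trig c F" "finite G" "Q = trig d G"
    using assms by (auto simp: trig_polys_def)
  have "(\<lambda>x. P x * Q x) = (\<lambda>x. \<Sum>j\<in>F. \<Sum>k\<in>G. c j * d k * cis (2 * pi * real_of_int (j + k) * x))"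
    unfolding * trig_def sum_product
    by (intro ext sum.cong refl) (simp add: cis_mult distrib_left distrib_right)
  also have "\<dots> \<in> trig_polys"
    by (intro trig_polys_sum trig_polys_cis)
  finally show ?thesis .
qed

text \<open>The bridge from Stone-Weierstrass: on the unit circle the real and imaginary parts are
  combinations of the characters with \<open>k = 1\<close> and \<open>k = - 1\<close>, and the rest
  of the induction only needs that \<open>trig_polys\<close> is an algebra.\<close>

lemma trig_polys_real_polynomial:
  assumes "real_polynomial_function (g :: complex \<Rightarrow> real)"
  shows "(\<lambda>x. complex_of_real (g (cis (2 * pi * x)))) \<in> trig_polys"
  using assms
proof induction
  case (linear f)
  have f: "f z = Re z * f 1 + Im z * f \<i>" for z
  proof -
    have "f z = f (Re z *\<^sub>R 1 + Im z *\<^sub>R \<i>)"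
      by (rule arg_cong[of _ _ f]) (simp add: complex_eq_iff)
    also have "\<dots> = Re z * f 1 + Im z * f \<i>"
      using linear by (simp add: linear_add linear_scale bounded_linear.linear)
    finally show ?thesis .
  qed
  \<comment> \<open>Chosen so that \<open>a * z + cnj a * cnj z\<close>, which is twice the real
    part of \<open>a * z\<close>, equals \<open>Re z * f 1 + Im z * f \<i>\<close>.\<close>
  define a where "a = (complex_of_real (f 1) - \<i> * complex_of_real (f \<i>)) / 2"
  have "complex_of_real (f (cis (2 * pi * x)))
      = a * cis (2 * pi * real_of_int 1 * x) + cnj a * cis (2 * pi * real_of_int (- 1) * x)" for x
    by (subst f) (simp add: a_def complex_eq_iff field_simps)
  then show ?case
    using trig_polys_add[OF trig_polys_cis trig_polys_cis, of a 1 "cnj a" "- 1"] by simp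
next
  case (const c)
  then show ?case by (rule trig_polys_const)
next
  case (add f g)
  then show ?case using trig_polys_add by fastforce
next
  case (mult f g)
  then show ?case using trig_polys_mult by fastforce
qed

lemma trig_polys_measurable:
  assumes "P \<in> trig_polys"
  shows "P \<in> borel_measurable borel"
  using assms by (auto simp: trig_polys_def trig_def[abs_def] cis_conv_exp intro!: borel_measurable_continuous_onI continuous_intros)

lemma trig_polys_bounded:
  assumes "P \<in> trig_polys"
  obtains C where "\<And>x. cmod (P x) \<le> C"
proof -
  obtain c F where "P = trig c F"
    using assms by (auto simp: trig_polys_def)
  then have "cmod (P x) \<le> (\<Sum>k\<in>F. cmod (c k))" for x
    by (auto simp: trig_def norm_mult intro: sum_norm_le)
  then show ?thesis ..
qed

section \<open>The \<open>L^2\<close> closure of the trigonometric polynomials\<close>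

lemma space_lebesgue_01 [simp]: "space lebesgue_01 = {0..<1}"
  by (simp add: lebesgue_01_def space_restrict_space)

lemma sets_lebesgue_01_iff: "A \<in> sets lebesgue_01 \<longleftrightarrow> A \<in> sets borel \<and> A \<subseteq> {0..<1}"
  by (auto simp: lebesgue_01_def sets_restrict_space_iff)

lemma finite_measure_lebesgue_01: "finite_measure lebesgue_01"
  by (rule finite_measureI) (simp add: lebesgue_01_def emeasure_restrict_space space_restrict_space)

lemma borel_measurable_01:
  assumes "sets M = sets lebesgue_01" "f \<in> borel_measurable borel"
  shows "f \<in> borel_measurable M"
  using assms by (subst measurable_cong_sets[OF assms(1) refl])
    (auto simp: lebesgue_01_def intro: measurable_restrict_space1)

text \<open>The library has no \<open>L\<^sup>2(M)\<close> space; this is membership in the \<open>L\<^sup>2\<close> closure of \<open>trig_polys\<close>.\<close>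
definition trig_approx :: "real measure \<Rightarrow> (real \<Rightarrow> complex) \<Rightarrow> bool" where
  "trig_approx M f \<longleftrightarrow> f \<in> borel_measurable M \<and>
     (\<forall>e>0. \<exists>P\<in>trig_polys. (\<integral>\<^sup>+x. ennreal ((cmod (f x - P x))\<^sup>2) \<partial>M) < ennreal e)"

lemma trig_approxE:
  assumes "trig_approx M f" "0 < e"
  obtains P where "P \<in> trig_polys" "(\<integral>\<^sup>+x. ennreal ((cmod (f x - P x))\<^sup>2) \<partial>M) \<le> ennreal e"
  using assms unfolding trig_approx_def by (meson less_imp_le)

lemma norm_diff_square_le:
  fixes a b c :: complex
  shows "(cmod (a - c))\<^sup>2 \<le> 2 * (cmod (a - b))\<^sup>2 + 2 * (cmod (b - c))\<^sup>2"
proof -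
  have "cmod (a - c) \<le> cmod (a - b) + cmod (b - c)"
    using norm_triangle_ineq[of "a - b" "b - c"] by simp
  then have "(cmod (a - c))\<^sup>2 \<le> (cmod (a - b) + cmod (b - c))\<^sup>2"
    by (rule power_mono) simp
  also have "\<dots> \<le> 2 * (cmod (a - b))\<^sup>2 + 2 * (cmod (b - c))\<^sup>2"
    using sum_squares_bound[of "cmod (a - b)" "cmod (b - c)"] by (simp add: power2_sum)
  finally show ?thesis .
qed

text \<open>A stand-in for Minkowski's inequality: it loses a factor 2 but works with squared
  distances throughout, so no roots of extended integrals occur.\<close>

lemma nn_integral_square_triangle:
  fixes f g h :: "'b \<Rightarrow> complex"
  assumes [measurable]: "f \<in> borel_measurable M" "g \<in> borel_measurable M" "h \<in> borel_measurable M"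
    and "(\<integral>\<^sup>+x. ennreal ((cmod (f x - g x))\<^sup>2) \<partial>M) \<le> ennreal d"
    and "(\<integral>\<^sup>+x. ennreal ((cmod (g x - h x))\<^sup>2) \<partial>M) \<le> ennreal e"
    and nonneg: "0 \<le> d" "0 \<le> e"
  shows "(\<integral>\<^sup>+x. ennreal ((cmod (f x - h x))\<^sup>2) \<partial>M) \<le> ennreal (2 * d + 2 * e)"
proof -
  have "(\<integral>\<^sup>+x. ennreal ((cmod (f x - h x))\<^sup>2) \<partial>M)
     \<le> (\<integral>\<^sup>+x. 2 * ennreal ((cmod (f x - g x))\<^sup>2) + 2 * ennreal ((cmod (g x - h x))\<^sup>2) \<partial>M)"
  proof (rule nn_integral_mono)
    fix x
    have "ennreal ((cmod (f x - h x))\<^sup>2) \<le> ennreal (2 * (cmod (f x - g x))\<^sup>2 + 2 * (cmod (g x - h x))\<^sup>2)"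
      by (rule ennreal_leI) (rule norm_diff_square_le)
    then show "ennreal ((cmod (f x - h x))\<^sup>2)
        \<le> 2 * ennreal ((cmod (f x - g x))\<^sup>2) + 2 * ennreal ((cmod (g x - h x))\<^sup>2)"
      by (simp add: ennreal_plus ennreal_mult)
  qed
  also have "\<dots> = 2 * (\<integral>\<^sup>+x. ennreal ((cmod (f x - g x))\<^sup>2) \<partial>M) + 2 * (\<integral>\<^sup>+x. ennreal ((cmod (g x - h x))\<^sup>2) \<partial>M)"
    by (simp add: nn_integral_add nn_integral_cmult)
  also have "\<dots> \<le> 2 * ennreal d + 2 * ennreal e"
    by (intro add_mono mult_left_mono assms) auto
  also have "\<dots> = ennreal (2 * d + 2 * e)"
    using nonneg by (simp add: ennreal_plus ennreal_mult)
  finally show ?thesis .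
qed

lemma trig_approx_lim:
  assumes M: "sets M = sets lebesgue_01" and f: "f \<in> borel_measurable M"
    and g: "\<And>e. 0 < e \<Longrightarrow> \<exists>g. trig_approx M g \<and> (\<integral>\<^sup>+x. ennreal ((cmod (f x - g x))\<^sup>2) \<partial>M) \<le> ennreal e"
  shows "trig_approx M f"
  unfolding trig_approx_def
proof (intro conjI f allI impI)
  fix e :: real assume e: "0 < e"
  \<comment> \<open>Each error is doubled by the squared triangle inequality, so two errors of
    \<open>e / 8\<close> add up to \<open>e / 2\<close>, which leaves the inequality strict.\<close>
  obtain g where g: "trig_approx M g" "(\<integral>\<^sup>+x. ennreal ((cmod (f x - g x))\<^sup>2) \<partial>M) \<le> ennreal (e / 8)"
    using g[of "e / 8"] e by auto
  obtain P where P: "P \<in> trig_polys" "(\<integral>\<^sup>+x. ennreal ((cmod (g x - P x))\<^sup>2) \<partial>M) \<le> ennreal (e / 8)"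
    by (rule trig_approxE[OF g(1), of "e / 8"]) (use e in auto)
  have "(\<integral>\<^sup>+x. ennreal ((cmod (f x - P x))\<^sup>2) \<partial>M) \<le> ennreal (2 * (e / 8) + 2 * (e / 8))"
    by (rule nn_integral_square_triangle[OF f _ _ g(2) P(2)])
      (use g(1) e P M in \<open>auto simp: trig_approx_def intro: borel_measurable_01 trig_polys_measurable\<close>)
  also have "\<dots> < ennreal e"
    using e by (simp add: ennreal_less_iff)
  finally show "\<exists>P\<in>trig_polys. (\<integral>\<^sup>+x. ennreal ((cmod (f x - P x))\<^sup>2) \<partial>M) < ennreal e"
    using P(1) by blast
qed

lemma trig_approx_trig:
  assumes "sets M = sets lebesgue_01" "P \<in> trig_polys"
  shows "trig_approx M P"
  unfolding trig_approx_def
  by (intro conjI allI impI bexI[of _ P] borel_measurable_01[OF assms(1)] trig_polys_measurable assms) simp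

lemma trig_approx_add:
  assumes M: "sets M = sets lebesgue_01" and f: "trig_approx M f" and g: "trig_approx M g"
  shows "trig_approx M (\<lambda>x. f x + g x)"
proof -
  have [measurable]: "f \<in> borel_measurable M" "g \<in> borel_measurable M"
    using f g by (auto simp: trig_approx_def)
  have "\<exists>P\<in>trig_polys. (\<integral>\<^sup>+x. ennreal ((cmod (f x + g x - P x))\<^sup>2) \<partial>M) < ennreal e" if e: "0 < e" for e
  proof -
    obtain P where P: "P \<in> trig_polys" "(\<integral>\<^sup>+x. ennreal ((cmod (f x - P x))\<^sup>2) \<partial>M) \<le> ennreal (e / 8)"
      by (rule trig_approxE[OF f, of "e / 8"]) (use e in auto)
    obtain Q where Q: "Q \<in> trig_polys" "(\<integral>\<^sup>+x. ennreal ((cmod (g x - Q x))\<^sup>2) \<partial>M) \<le> ennreal (e / 8)"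
      by (rule trig_approxE[OF g, of "e / 8"]) (use e in auto)
    have [measurable]: "P \<in> borel_measurable M" "Q \<in> borel_measurable M"
      using P Q M by (auto intro: borel_measurable_01 trig_polys_measurable)
    have "(\<integral>\<^sup>+x. ennreal ((cmod ((f x + g x) - (P x + Q x)))\<^sup>2) \<partial>M) \<le> ennreal (2 * (e / 8) + 2 * (e / 8))"
      by (rule nn_integral_square_triangle[where g = "\<lambda>x. P x + g x"]) (use P Q e in \<open>simp_all add: algebra_simps\<close>)
    also have "\<dots> < ennreal e"
      using e by (simp add: ennreal_less_iff)
    finally show ?thesis
      using trig_polys_add[OF P(1) Q(1)] by (intro bexI[of _ "\<lambda>x. P x + Q x"])
  qed
  moreover have "(\<lambda>x. f x + g x) \<in> borel_measurable M"
    by measurable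
  ultimately show ?thesis
    unfolding trig_approx_def by blast
qed

lemma trig_approx_cmult:
  assumes M: "sets M = sets lebesgue_01" and f: "trig_approx M f"
  shows "trig_approx M (\<lambda>x. c * f x)"
proof -
  have [measurable]: "f \<in> borel_measurable M"
    using f by (auto simp: trig_approx_def)
  have "\<exists>P\<in>trig_polys. (\<integral>\<^sup>+x. ennreal ((cmod (c * f x - P x))\<^sup>2) \<partial>M) < ennreal e" if e: "0 < e" for e
  proof -
    \<comment> \<open>Adding 1 allows division by \<open>C\<close> even for \<open>c = 0\<close> and
      makes the final estimate strict.\<close>
    define C where "C = (cmod c)\<^sup>2 + 1"
    have C: "0 < C" by (auto simp: C_def add_nonneg_pos)
    obtain P where P: "P \<in> trig_polys" "(\<integral>\<^sup>+x. ennreal ((cmod (f x - P x))\<^sup>2) \<partial>M) \<le> ennreal (e / C)"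
      by (rule trig_approxE[OF f, of "e / C"]) (use e C in auto)
    have [measurable]: "P \<in> borel_measurable M"
      using P M by (auto intro: borel_measurable_01 trig_polys_measurable)
    have "(\<integral>\<^sup>+x. ennreal ((cmod (c * f x - c * P x))\<^sup>2) \<partial>M)
        = (\<integral>\<^sup>+x. ennreal ((cmod c)\<^sup>2) * ennreal ((cmod (f x - P x))\<^sup>2) \<partial>M)"
      by (simp add: norm_mult power_mult_distrib ennreal_mult flip: right_diff_distrib)
    also have "\<dots> = ennreal ((cmod c)\<^sup>2) * (\<integral>\<^sup>+x. ennreal ((cmod (f x - P x))\<^sup>2) \<partial>M)"
      by (simp add: nn_integral_cmult)
    also have "\<dots> \<le> ennreal ((cmod c)\<^sup>2) * ennreal (e / C)"
      using P(2) by (intro mult_left_mono) auto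
    also have "\<dots> = ennreal ((cmod c)\<^sup>2 * (e / C))"
      using e C by (intro ennreal_mult[symmetric]) auto
    also have "\<dots> < ennreal e"
      using e C by (subst ennreal_less_iff) (auto simp: C_def field_simps)
    finally show ?thesis
      using trig_polys_mult[OF trig_polys_const P(1), of c] by (intro bexI[of _ "\<lambda>x. c * P x"])
  qed
  moreover have "(\<lambda>x. c * f x) \<in> borel_measurable M"
    by measurable
  ultimately show ?thesis
    unfolding trig_approx_def by blast
qed

lemma trig_approx_sum:
  assumes M: "sets M = sets lebesgue_01" and f: "\<And>i. i \<in> I \<Longrightarrow> trig_approx M (f i)"
  shows "trig_approx M (\<lambda>x. \<Sum>i\<in>I. f i x)"
  using f
proof (induction I rule: infinite_finite_induct)
  case (infinite I)
  show ?case
    unfolding sum.infinite[OF infinite(1)] by (rule trig_approx_trig[OF M trig_polys_const])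
next
  case empty
  show ?case
    unfolding sum.empty by (rule trig_approx_trig[OF M trig_polys_const])
next
  case (insert i I)
  show ?case
    unfolding sum.insert[OF insert(1,2)]
    by (intro trig_approx_add[OF M] insert.IH) (use insert.prems in auto)
qed

text \<open>Stone-Weierstrass on the circle gives uniform approximation, which on a finite measure
  implies \<open>L^2\<close> approximation. Composing \<open>h\<close> with \<open>cis\<close>
  builds in the agreement at the two ends of the interval.\<close>

lemma trig_approx_continuous:
  assumes M: "sets M = sets lebesgue_01" and fin: "finite_measure M"
    and h: "continuous_on UNIV (h :: complex \<Rightarrow> real)"
  shows "trig_approx M (\<lambda>x. complex_of_real (h (cis (2 * pi * x))))"
proof (rule trig_approx_lim[OF M])
  have "(\<lambda>x. complex_of_real (h (cis (2 * pi * x)))) \<in> borel_measurable borel"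
    by (intro borel_measurable_continuous_onI continuous_intros continuous_on_compose2[OF h])
      (auto simp: cis_conv_exp intro!: continuous_intros)
  then show "(\<lambda>x. complex_of_real (h (cis (2 * pi * x)))) \<in> borel_measurable M"
    by (rule borel_measurable_01[OF M])
next
  fix e :: real assume e: "0 < e"
  define m where "m = measure M (space M)"
  \<comment> \<open>The uniform error contributes at most \<open>d\<^sup>2 * m\<close>, hence at
    most \<open>e\<close>; the added 1 covers total mass zero.\<close>
  define d where "d = sqrt (e / (m + 1))"
  have m: "0 \<le> m" "emeasure M (space M) = ennreal m"
    using fin by (auto simp: m_def finite_measure.emeasure_eq_measure)
  have d: "0 < d" using e m by (simp add: d_def)
  have "continuous_on (sphere 0 1) h"
    using h by (rule continuous_on_subset) simp
  from Stone_Weierstrass_polynomial_function[OF compact_sphere this d]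
  obtain g where g: "polynomial_function g" "\<forall>z\<in>sphere 0 1. norm (h z - g z) < d"
    by auto
  have "(\<integral>\<^sup>+x. ennreal ((cmod (complex_of_real (h (cis (2 * pi * x))) - complex_of_real (g (cis (2 * pi * x)))))\<^sup>2) \<partial>M)
     \<le> (\<integral>\<^sup>+x. ennreal (d\<^sup>2) \<partial>M)"
  proof (intro nn_integral_mono ennreal_leI)
    fix x
    have "\<bar>h (cis (2 * pi * x)) - g (cis (2 * pi * x))\<bar> \<le> d"
      using bspec[OF g(2), of "cis (2 * pi * x)"] by simp
    then have "\<bar>h (cis (2 * pi * x)) - g (cis (2 * pi * x))\<bar>\<^sup>2 \<le> d\<^sup>2"
      by (rule power_mono) simp
    then show "(cmod (complex_of_real (h (cis (2 * pi * x))) - complex_of_real (g (cis (2 * pi * x)))))\<^sup>2 \<le> d\<^sup>2"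
      by (simp flip: of_real_diff)
  qed
  also have "\<dots> = ennreal (d\<^sup>2 * m)"
    using m by (simp add: ennreal_mult)
  also have "\<dots> \<le> ennreal e"
    using e m by (intro ennreal_leI) (simp add: d_def field_simps)
  finally show "\<exists>g. trig_approx M g \<and>
      (\<integral>\<^sup>+x. ennreal ((cmod (complex_of_real (h (cis (2 * pi * x))) - g x))\<^sup>2) \<partial>M) \<le> ennreal e"
    using trig_approx_trig[OF M trig_polys_real_polynomial[of g]] g(1)
    by (intro exI[of _ "\<lambda>x. complex_of_real (g (cis (2 * pi * x)))"] conjI)
      (simp_all add: real_polynomial_function_eq)
qed

text \<open>A Borel left inverse of \<open>x \<mapsto> cis (2 * pi * x)\<close> on
  \<open>[0,1)\<close>, defined on the whole plane. The clamp to \<open>[-1,1]\<close> keeps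
  \<open>arccos\<close> within its domain of continuity; the sign of \<open>Im z\<close> selects the
  half circle.\<close>

definition circle_arg :: "complex \<Rightarrow> real" where
  "circle_arg z = (let t = arccos (max (- 1) (min 1 (Re z))) / (2 * pi) in if 0 \<le> Im z then t else 1 - t)"

lemma circle_arg_measurable [measurable]: "circle_arg \<in> borel_measurable borel"
proof -
  have "(\<lambda>z. arccos (max (- 1) (min 1 (Re z)))) \<in> borel_measurable borel"
    by (intro borel_measurable_continuous_onI continuous_intros) auto
  then show ?thesis
    unfolding circle_arg_def[abs_def] Let_def by measurable
qed

lemma circle_arg_cis:
  assumes "0 \<le> x" "x < 1"
  shows "circle_arg (cis (2 * pi * x)) = x"
proof (cases "x \<le> 1 / 2")
  case True
  have "0 \<le> sin (2 * pi * x)"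
    by (rule sin_ge_zero) (use assms True in \<open>auto simp: field_simps\<close>)
  moreover have "arccos (cos (2 * pi * x)) = 2 * pi * x"
    by (rule arccos_cos) (use assms True in \<open>auto simp: field_simps\<close>)
  ultimately show ?thesis
    by (simp add: circle_arg_def)
next
  case False
  have "sin (2 * pi * x) < 0"
    by (rule sin_lt_zero) (use assms False in \<open>auto simp: field_simps\<close>)
  moreover have "arccos (cos (2 * pi * x)) = 2 * pi - 2 * pi * x"
  proof -
    have "cos (2 * pi * x) = cos (2 * pi - 2 * pi * x)"
      by (simp add: cos_diff)
    then show ?thesis
      using assms False by (simp add: arccos_cos field_simps)
  qed
  ultimately show ?thesis
    by (simp add: circle_arg_def field_simps)
qed

text \<open>The measure is pushed to the plane, where finite Borel measures are outer regular. Open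
  sets slightly larger than a Borel set and than its complement yield, by Urysohn, a continuous
  function that equals the indicator outside a set of small measure.\<close>

lemma trig_approx_indicator:
  assumes M: "sets M = sets lebesgue_01" and fin: "finite_measure M" and A: "A \<in> sets M"
  shows "trig_approx M (indicator A)"
proof (rule trig_approx_lim[OF M])
  show "(indicator A :: real \<Rightarrow> complex) \<in> borel_measurable M"
    using A by simp
next
  fix e :: real assume e: "0 < e"
  interpret finite_measure M by (rule fin)
  have space: "space M = {0..<1}"
    using sets_eq_imp_space_eq[OF M] by simp
  have A': "A \<in> sets borel" "A \<subseteq> {0..<1}"
    using A by (auto simp: M sets_lebesgue_01_iff)
  define N where "N = distr M borel (\<lambda>x. cis (2 * pi * x))"
  \<comment> \<open>On \<open>space M\<close> this plane set is hit by
    \<open>cis (2 * pi * x)\<close> exactly for \<open>x \<in> A\<close>, and it is Borel because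
    \<open>circle_arg\<close> is measurable.\<close>
  define B where "B = circle_arg -` A"
  have [measurable]: "(\<lambda>x. cis (2 * pi * x)) \<in> borel_measurable M"
    by (rule borel_measurable_01[OF M], intro borel_measurable_continuous_onI)
      (auto simp: cis_conv_exp intro!: continuous_intros)
  have B: "B \<in> sets borel"
    using measurable_sets[OF circle_arg_measurable A'(1)] by (simp add: B_def)
  have memB: "cis (2 * pi * x) \<in> B \<longleftrightarrow> x \<in> A" if "x \<in> space M" for x
    using that by (simp add: B_def circle_arg_cis space)
  have finN: "finite_measure N"
    unfolding N_def by (rule finite_measure_distr) simp
  then have top: "emeasure N X \<noteq> \<infinity>" for X
    by (simp add: finite_measure.emeasure_finite)
  have setsN: "sets N = sets borel" by (simp add: N_def)
  have outer: "\<exists>U. X \<subseteq> U \<and> open U \<and> emeasure N (U - X) \<le> ennreal (e / 2)"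
    if X: "X \<in> sets borel" for X
  proof -
    have "(INF U \<in> {U. X \<subseteq> U \<and> open U}. emeasure N U) = emeasure N X"
      using outer_regular[OF setsN top X] by simp
    also have "\<dots> < emeasure N X + ennreal (e / 2)"
      using top[of X] e by (cases "emeasure N X") (auto simp: ennreal_less_iff simp flip: ennreal_plus)
    finally obtain U where U: "X \<subseteq> U" "open U" "emeasure N U < emeasure N X + ennreal (e / 2)"
      unfolding INF_less_iff by blast
    have "emeasure N (U - X) = emeasure N U - emeasure N X"
      using U X top[of X] setsN by (intro emeasure_Diff) auto
    also have "\<dots> \<le> ennreal (e / 2)"
      using U(3) top[of U] by (simp add: ennreal_minus_le_iff add.commute less_imp_le)
    finally show ?thesis
      using U by blast
  qed
  obtain U where U: "B \<subseteq> U" "open U" "emeasure N (U - B) \<le> ennreal (e / 2)"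
    using outer[OF B] by blast
  obtain V where V: "- B \<subseteq> V" "open V" "emeasure N (V - (- B)) \<le> ennreal (e / 2)"
    using outer[OF borel_comp[OF B]] by blast
  \<comment> \<open>The two closed sets are disjoint because \<open>U\<close> covers
    \<open>B\<close> and \<open>V\<close> covers its complement.\<close>
  have "closedin (top_of_set UNIV) (- V)" "closedin (top_of_set UNIV) (- U)" "- V \<inter> - U = {}"
    using U V by (auto simp: closed_def)
  then obtain h :: "complex \<Rightarrow> real" where h: "continuous_on UNIV h"
      "\<And>z. h z \<in> closed_segment 1 0" "\<And>z. z \<in> - V \<Longrightarrow> h z = 1" "\<And>z. z \<in> - U \<Longrightarrow> h z = 0"
    by (rule Urysohn_local[where a = 1 and b = "0::real"]) auto
  have UV: "U - B \<union> (V - (- B)) \<in> sets borel"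
    using B U V by auto
  have "(\<integral>\<^sup>+x. ennreal ((cmod (indicator A x - complex_of_real (h (cis (2 * pi * x)))))\<^sup>2) \<partial>M)
     \<le> (\<integral>\<^sup>+x. indicator (U - B \<union> (V - (- B))) (cis (2 * pi * x)) \<partial>M)"
  proof (rule nn_integral_mono)
    fix x assume x: "x \<in> space M"
    let ?z = "cis (2 * pi * x)"
    have h01: "0 \<le> h ?z" "h ?z \<le> 1"
      using h(2)[of ?z] by (auto simp: closed_segment_eq_real_ivl)
    show "ennreal ((cmod (indicator A x - complex_of_real (h ?z)))\<^sup>2)
        \<le> indicator (U - B \<union> (V - (- B))) ?z"
    proof (cases "?z \<in> U - B \<union> (V - (- B))")
      case True
      have "cmod (indicator A x - complex_of_real (h ?z)) = \<bar>indicator A x - h ?z\<bar>"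
        by (metis norm_of_real of_real_diff of_real_indicator)
      also have "\<dots> \<le> 1"
        using h01 by (auto simp: indicator_def)
      finally have "(cmod (indicator A x - complex_of_real (h ?z)))\<^sup>2 \<le> 1"
        by (simp add: power_le_one)
      then show ?thesis
        using True by simp
    next
      case False
      \<comment> \<open>Off the exceptional set, a point of \<open>B\<close> lies outside
        \<open>V\<close> and a point outside \<open>B\<close> lies outside \<open>U\<close>, so
        \<open>h\<close> has the value prescribed there.\<close>
      then have "h ?z = indicator A x"
        using memB[OF x] h(3,4)[of ?z] U(1) V(1) by (cases "x \<in> A") auto
      then show ?thesis by (cases "x \<in> A") simp_all
    qed
  qed
  also have "\<dots> = (\<integral>\<^sup>+z. indicator (U - B \<union> (V - (- B))) z \<partial>N)"
    unfolding N_def using UV by (subst nn_integral_distr) auto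
  also have "\<dots> = emeasure N (U - B \<union> (V - (- B)))"
    using UV setsN by simp
  also have "\<dots> \<le> emeasure N (U - B) + emeasure N (V - (- B))"
    using B U V setsN by (intro emeasure_subadditive) auto
  also have "\<dots> \<le> ennreal (e / 2) + ennreal (e / 2)"
    using U V by (intro add_mono)
  also have "\<dots> = ennreal e"
    using e by (simp flip: ennreal_plus)
  finally show "\<exists>g. trig_approx M g \<and> (\<integral>\<^sup>+x. ennreal ((cmod (indicator A x - g x))\<^sup>2) \<partial>M) \<le> ennreal e"
    using trig_approx_continuous[OF M fin h(1)] by (intro exI[of _ "\<lambda>x. complex_of_real (h (cis (2 * pi * x)))"] conjI)
qed

lemma trig_approx_cong:
  assumes eq: "\<And>x. x \<in> space M \<Longrightarrow> f x = g x" and f: "trig_approx M f"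
  shows "trig_approx M g"
proof -
  have "g \<in> borel_measurable M"
    using f measurable_cong[of M f g borel, OF eq] by (simp add: trig_approx_def)
  moreover have "(\<integral>\<^sup>+x. ennreal ((cmod (f x - P x))\<^sup>2) \<partial>M) = (\<integral>\<^sup>+x. ennreal ((cmod (g x - P x))\<^sup>2) \<partial>M)" for P
    by (rule nn_integral_cong) (simp add: eq)
  ultimately show ?thesis
    using f by (simp add: trig_approx_def)
qed

text \<open>The expansion of a simple function into indicators holds only on \<open>space M\<close>,
  hence the detour through \<open>trig_approx_cong\<close>.\<close>

lemma trig_approx_simple:
  assumes M: "sets M = sets lebesgue_01" and fin: "finite_measure M"
    and s: "simple_function M (s :: real \<Rightarrow> complex)"
  shows "trig_approx M s"
proof (rule trig_approx_cong)
  fix x assume "x \<in> space M"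
  from simple_function_indicator_representation_banach[OF s this]
  show "(\<Sum>y\<in>s ` space M. y * indicator (s -` {y} \<inter> space M) x) = s x"
    by (simp only: scaleR_conv_of_real of_real_indicator mult.commute)
next
  have "s -` {y} \<inter> space M \<in> sets M" for y
    by (rule simple_functionD(2)[OF s])
  then show "trig_approx M (\<lambda>x. \<Sum>y\<in>s ` space M. y * indicator (s -` {y} \<inter> space M) x)"
    by (intro trig_approx_sum[OF M] trig_approx_cmult[OF M] trig_approx_indicator[OF M fin])
qed

text \<open>Simple functions bounded by \<open>2 * cmod (f x)\<close> converge pointwise to
  \<open>f\<close>; the squared errors are dominated by \<open>9 * (cmod (f x))\<^sup>2\<close>, so
  dominated convergence applies.\<close>

theorem trig_approx_L2:
  assumes M: "sets M = sets lebesgue_01" and fin: "finite_measure M"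
    and f [measurable]: "f \<in> borel_measurable M"
    and L2: "(\<integral>\<^sup>+x. ennreal ((cmod (f x))\<^sup>2) \<partial>M) < \<infinity>"
  shows "trig_approx M f"
proof (rule trig_approx_lim[OF M f])
  fix e :: real assume e: "0 < e"
  obtain s where s: "\<And>i. simple_function M (s i)"
    "\<And>x. x \<in> space M \<Longrightarrow> (\<lambda>i. s i x) \<longlonglongrightarrow> f x"
    "\<And>i x. x \<in> space M \<Longrightarrow> dist (s i x) 0 \<le> 2 * dist (f x) 0"
    using borel_measurable_implies_sequence_metric[OF f, of 0] by metis
  have [measurable]: "s i \<in> borel_measurable M" for i
    using s(1) by (rule borel_measurable_simple_function)
  have "(\<lambda>i. \<integral>\<^sup>+x. ennreal ((cmod (f x - s i x))\<^sup>2) \<partial>M) \<longlonglongrightarrow> (\<integral>\<^sup>+x. 0 \<partial>M)"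
  proof (rule nn_integral_dominated_convergence[where w = "\<lambda>x. 9 * ennreal ((cmod (f x))\<^sup>2)"])
    show "AE x in M. ennreal ((cmod (f x - s i x))\<^sup>2) \<le> 9 * ennreal ((cmod (f x))\<^sup>2)" for i
    proof (rule AE_I2)
      fix x assume "x \<in> space M"
      then have "cmod (f x - s i x) \<le> 3 * cmod (f x)"
        using s(3)[of x i] norm_triangle_ineq4[of "f x" "s i x"] by simp
      then have "(cmod (f x - s i x))\<^sup>2 \<le> (3 * cmod (f x))\<^sup>2"
        by (rule power_mono) simp
      then have "ennreal ((cmod (f x - s i x))\<^sup>2) \<le> ennreal (9 * (cmod (f x))\<^sup>2)"
        by (intro ennreal_leI) (simp add: power_mult_distrib)
      then show "ennreal ((cmod (f x - s i x))\<^sup>2) \<le> 9 * ennreal ((cmod (f x))\<^sup>2)"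
        by (simp add: ennreal_mult)
    qed
    show "(\<integral>\<^sup>+x. 9 * ennreal ((cmod (f x))\<^sup>2) \<partial>M) < \<infinity>"
      using L2 by (simp add: nn_integral_cmult ennreal_mult_less_top)
    show "AE x in M. (\<lambda>i. ennreal ((cmod (f x - s i x))\<^sup>2)) \<longlonglongrightarrow> 0"
    proof (rule AE_I2)
      fix x assume x: "x \<in> space M"
      have "(\<lambda>i. ennreal ((cmod (f x - s i x))\<^sup>2)) \<longlonglongrightarrow> ennreal ((cmod (f x - f x))\<^sup>2)"
        by (intro tendsto_ennrealI tendsto_intros s(2) x)
      then show "(\<lambda>i. ennreal ((cmod (f x - s i x))\<^sup>2)) \<longlonglongrightarrow> 0" by simp
    qed
  qed auto
  then have "(\<lambda>i. \<integral>\<^sup>+x. ennreal ((cmod (f x - s i x))\<^sup>2) \<partial>M) \<longlonglongrightarrow> 0" by simp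
  then have "eventually (\<lambda>i. (\<integral>\<^sup>+x. ennreal ((cmod (f x - s i x))\<^sup>2) \<partial>M) < ennreal e) sequentially"
    by (rule order_tendstoD) (use e in simp)
  then obtain i where "(\<integral>\<^sup>+x. ennreal ((cmod (f x - s i x))\<^sup>2) \<partial>M) < ennreal e"
    by (meson eventually_sequentially order_refl)
  then show "\<exists>g. trig_approx M g \<and> (\<integral>\<^sup>+x. ennreal ((cmod (f x - g x))\<^sup>2) \<partial>M) \<le> ennreal e"
    using trig_approx_simple[OF M fin s(1)] by (meson less_imp_le)
qed

section \<open>Trigonometric polynomials of a unitary\<close>

text \<open>This is the polynomial \<open>trig c F\<close> with \<open>T\<close> in place of
  \<open>cis (2 * pi * x)\<close>, applied to \<open>\<phi>\<close>.\<close>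

definition opvec :: "('a::complex_inner \<Rightarrow> 'a) \<Rightarrow> 'a \<Rightarrow> (int \<Rightarrow> complex) \<Rightarrow> int set \<Rightarrow> 'a" where
  "opvec T \<phi> c F = (\<Sum>k\<in>F. scaleC (c k) (upow T k \<phi>))"

text \<open>\<open>trig_vec T \<phi> P v\<close> encodes \<open>v = P(T)\<phi>\<close>; as a relation it needs no proof that the coefficients
  of \<open>P\<close> are unique.\<close>
definition trig_vec :: "('a::complex_inner \<Rightarrow> 'a) \<Rightarrow> 'a \<Rightarrow> (real \<Rightarrow> complex) \<Rightarrow> 'a \<Rightarrow> bool" where
  "trig_vec T \<phi> P v \<longleftrightarrow> (\<exists>c F. finite F \<and> P = trig c F \<and> v = opvec T \<phi> c F)"

lemma opvec_extend:
  assumes "finite G" "F \<subseteq> G"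
  shows "opvec T \<phi> c F = opvec T \<phi> (\<lambda>k. if k \<in> F then c k else 0) G"
  unfolding opvec_def by (rule sum.mono_neutral_cong_left) (use assms in auto)

lemma trig_vec_add:
  assumes "trig_vec T \<phi> P v" "trig_vec T \<phi> Q w"
  shows "trig_vec T \<phi> (\<lambda>x. P x + Q x) (v + w)"
proof -
  obtain c F d G where *: "finite F" "P = trig c F" "v = opvec T \<phi> c F"
      "finite G" "Q = trig d G" "w = opvec T \<phi> d G"
    using assms by (auto simp: trig_vec_def)
  let ?c = "\<lambda>k. if k \<in> F then c k else 0" and ?d = "\<lambda>k. if k \<in> G then d k else 0"
  have "P = trig ?c (F \<union> G)" "Q = trig ?d (F \<union> G)"
    unfolding * by (rule trig_extend; use * in simp)+
  then have "(\<lambda>x. P x + Q x) = trig (\<lambda>k. ?c k + ?d k) (F \<union> G)"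
    by (intro ext) (simp only: trig_def sum.distrib distrib_right)
  moreover have "v = opvec T \<phi> ?c (F \<union> G)" "w = opvec T \<phi> ?d (F \<union> G)"
    unfolding * by (rule opvec_extend; use * in simp)+
  then have "v + w = opvec T \<phi> (\<lambda>k. ?c k + ?d k) (F \<union> G)"
    by (simp only: opvec_def sum.distrib scaleC_add_left)
  ultimately show ?thesis
    using * unfolding trig_vec_def by (intro exI[of _ "\<lambda>k. ?c k + ?d k"] exI[of _ "F \<union> G"]) auto
qed

lemma trig_vec_monom:
  "trig_vec T \<phi> (\<lambda>x. c * cis (2 * pi * real_of_int k * x)) (scaleC c (upow T k \<phi>))"
  unfolding trig_vec_def
  by (rule exI[of _ "\<lambda>_. c"], rule exI[of _ "{k}"]) (auto simp: trig_def opvec_def)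

lemma trig_vec_one: "trig_vec T \<phi> (\<lambda>x. 1) \<phi>"
  using trig_vec_monom[of T \<phi> 1 0] by (simp add: scaleC_one)

lemma trig_vec_sum:
  "(\<And>i. i \<in> I \<Longrightarrow> trig_vec T \<phi> (P i) (v i)) \<Longrightarrow> trig_vec T \<phi> (\<lambda>x. \<Sum>i\<in>I. P i x) (\<Sum>i\<in>I. v i)"
proof (induction I rule: infinite_finite_induct)
  case (insert i I)
  show ?case
    unfolding sum.insert[OF insert(1,2)] by (intro trig_vec_add insert.IH) (use insert.prems in auto)
qed (use trig_vec_monom[of T \<phi> 0 0] in simp_all)

text \<open>The spectral correspondence: applying a power of \<open>T\<close> to the vector
  multiplies its polynomial by a character.\<close>

lemma trig_vec_shift:
  assumes T: "unitary T" and "trig_vec T \<phi> P v"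
  shows "trig_vec T \<phi> (\<lambda>x. d * cis (2 * pi * real_of_int k * x) * P x) (scaleC d (upow T k v))"
proof -
  obtain c F where *: "P = trig c F" "v = opvec T \<phi> c F"
    using assms by (auto simp: trig_vec_def)
  have lin: "upow T k (x + y) = upow T k x + upow T k y" "upow T k (scaleC a x) = scaleC a (upow T k x)" for x y a
    using unitary_upow[OF T, of k] by (auto simp: unitary_def)
  have "upow T k 0 = 0"
    using lin(2)[of 0 0] by simp
  then have "upow T k (sum f F) = (\<Sum>j\<in>F. upow T k (f j))" for f :: "int \<Rightarrow> 'a"
    by (induction F rule: infinite_finite_induct) (auto simp: lin)
  then have "scaleC d (upow T k v) = (\<Sum>j\<in>F. scaleC (d * c j) (upow T (k + j) \<phi>))"
    by (simp add: * opvec_def lin scaleC_sum_right scaleC_scaleC upow_add[OF unitary_bij[OF T]])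
  moreover have "(\<lambda>x. d * cis (2 * pi * real_of_int k * x) * P x)
      = (\<lambda>x. \<Sum>j\<in>F. d * c j * cis (2 * pi * real_of_int (k + j) * x))"
    unfolding * trig_def sum_distrib_left
    by (intro ext sum.cong refl) (simp add: cis_mult distrib_left distrib_right)
  ultimately show ?thesis
    using trig_vec_sum[where I = F, OF trig_vec_monom, of T \<phi> "\<lambda>j. d * c j" "\<lambda>j. k + j"] by simp
qed

text \<open>Polynomials of \<open>T\<close> compose by multiplication. This transfers an
  approximation built over one cyclic vector to another.\<close>

lemma trig_vec_mult:
  assumes "unitary T" "trig_vec T \<phi> P v"
  shows "trig_vec T \<phi> (\<lambda>x. trig d G x * P x) (opvec T v d G)"
  unfolding trig_def opvec_def sum_distrib_right
  by (intro trig_vec_sum trig_vec_shift assms)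

lemma trig_vec_diff:
  assumes "unitary T" "trig_vec T \<phi> P v" "trig_vec T \<phi> Q w"
  shows "trig_vec T \<phi> (\<lambda>x. P x - Q x) (v - w)"
  using trig_vec_add[OF assms(2) trig_vec_shift[OF assms(1,3), of "- 1" 0]]
  by (simp add: scaleC_minus_one)

lemma trig_vec_trig_polys: "trig_vec T \<phi> P v \<Longrightarrow> P \<in> trig_polys"
  by (auto simp: trig_vec_def trig_polys_def)

lemma trig_polys_vec:
  assumes "P \<in> trig_polys"
  obtains v where "trig_vec T \<phi> P v"
  using assms by (auto simp: trig_vec_def trig_polys_def)

text \<open>\<open>cspan\<close> sums over a set of vectors, \<open>trig_vec\<close> over exponents,
  and distinct exponents may give the same vector. One direction picks an exponent for each vector;
  the other merges coefficients.\<close>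

lemma cspan_orbit: "cspan (range (\<lambda>k. upow T k \<phi>)) = {v. \<exists>P. trig_vec T \<phi> P v}"
proof (intro set_eqI iffI)
  fix v assume "v \<in> cspan (range (\<lambda>k. upow T k \<phi>))"
  then obtain S c where S: "finite S" "S \<subseteq> range (\<lambda>k. upow T k \<phi>)" "v = (\<Sum>x\<in>S. scaleC (c x) x)"
    by (auto simp: cspan_def)
  then obtain G where G: "inj_on (\<lambda>k. upow T k \<phi>) G" "S = (\<lambda>k. upow T k \<phi>) ` G"
    using subset_image_inj[of S "\<lambda>k. upow T k \<phi>" UNIV] by auto
  have "v = opvec T \<phi> (\<lambda>k. c (upow T k \<phi>)) G"
    unfolding S(3) G(2) opvec_def by (subst sum.reindex[OF G(1)]) simp
  moreover have "finite G"
    using S(1) G by (simp add: finite_image_iff)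
  ultimately show "v \<in> {v. \<exists>P. trig_vec T \<phi> P v}"
    by (auto simp: trig_vec_def)
next
  fix v assume "v \<in> {v. \<exists>P. trig_vec T \<phi> P v}"
  then obtain c F where *: "finite F" "v = opvec T \<phi> c F"
    by (auto simp: trig_vec_def)
  \<comment> \<open>Exponents are grouped by the orbit vector they produce.\<close>
  have "v = (\<Sum>y\<in>(\<lambda>k. upow T k \<phi>) ` F. \<Sum>k\<in>{k \<in> F. upow T k \<phi> = y}. scaleC (c k) (upow T k \<phi>))"
    unfolding *(2) opvec_def by (rule sum.image_gen[OF *(1)])
  also have "\<dots> = (\<Sum>y\<in>(\<lambda>k. upow T k \<phi>) ` F. scaleC (\<Sum>k\<in>{k \<in> F. upow T k \<phi> = y}. c k) y)"
    by (intro sum.cong refl) (simp add: scaleC_sum_left)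
  finally show "v \<in> cspan (range (\<lambda>k. upow T k \<phi>))"
    unfolding cspan_def using *(1)
    by (intro CollectI exI[of _ "(\<lambda>k. upow T k \<phi>) ` F"] exI[of _ "\<lambda>y. \<Sum>k\<in>{k \<in> F. upow T k \<phi> = y}. c k"])
      auto
qed

lemma trig_vec_in_cyclic: "trig_vec T \<phi> P v \<Longrightarrow> v \<in> cyclic_subspace T \<phi>"
  unfolding cyclic_subspace_def cspan_orbit by (rule subsetD[OF closure_subset]) auto

lemma opvec_tendsto:
  assumes "unitary T" "(w \<longlongrightarrow> \<phi>) H"
  shows "((\<lambda>n. opvec T (w n) c F) \<longlongrightarrow> opvec T \<phi> c F) H"
  unfolding opvec_def
  by (intro tendsto_sum tendsto_scaleC unitary_tendsto[OF unitary_upow[OF assms(1)] assms(2)])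

text \<open>If vectors \<open>P(T)\<phi>\<close> approach \<open>w\<close>, then the vectors
  \<open>(QP)(T)\<phi>\<close> approach \<open>Q(T)w\<close> for each fixed polynomial
  \<open>Q\<close>, and a closure is closed.\<close>

lemma cyclic_subspace_mono:
  assumes T: "unitary T" and w: "w \<in> cyclic_subspace T \<phi>"
  shows "cyclic_subspace T w \<subseteq> cyclic_subspace T \<phi>"
proof -
  define V where "V = {v. \<exists>P. trig_vec T \<phi> P v}"
  have V: "cyclic_subspace T \<phi> = closure V"
    by (simp add: V_def cyclic_subspace_def cspan_orbit)
  obtain s where s: "\<forall>n. s n \<in> V" "s \<longlonglongrightarrow> w"
    using w unfolding V closure_sequential by blast
  have "opvec T w c F \<in> closure V" for c F
    unfolding closure_sequential
  proof (intro exI conjI allI)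
    fix n
    obtain P where "trig_vec T \<phi> P (s n)"
      using spec[OF s(1), of n] unfolding V_def by blast
    from trig_vec_mult[OF T this, of c F] show "opvec T (s n) c F \<in> V"
      unfolding V_def by blast
    show "(\<lambda>n. opvec T (s n) c F) \<longlonglongrightarrow> opvec T w c F"
      by (rule opvec_tendsto[OF T s(2)])
  qed
  then have "cspan (range (\<lambda>k. upow T k w)) \<subseteq> closure V"
    unfolding cspan_orbit trig_vec_def by blast
  then show ?thesis
    unfolding V unfolding cyclic_subspace_def by (rule closure_minimal) simp
qed

section \<open>The isometry from polynomials in \<open>L^2\<close> of the spectral measure to
  vectors\<close>

lemma trig_polys_integrable:
  assumes "sets M = sets lebesgue_01" "finite_measure M" "P \<in> trig_polys"
  shows "integrable M P"
proof -
  obtain C where "\<And>x. cmod (P x) \<le> C"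
    using trig_polys_bounded[OF assms(3)] by blast
  then show ?thesis
    by (intro finite_measure.integrable_const_bound[OF assms(2), of _ C] borel_measurable_01[OF assms(1)]
        trig_polys_measurable assms) auto
qed

text \<open>Stated for an arbitrary finite measure because it serves both the spectral measure and
  Lebesgue measure; only the moments differ.\<close>

lemma integral_cnj_trig_mult_trig:
  assumes "sets M = sets lebesgue_01" "finite_measure M"
  shows "(LINT x|M. cnj (trig c F x) * trig d G x)
    = (\<Sum>j\<in>F. \<Sum>k\<in>G. cnj (c j) * d k * (LINT x|M. cis (2 * pi * real_of_int (k - j) * x)))"
proof -
  have int: "integrable M (\<lambda>x. a * cis (2 * pi * real_of_int k * x))" for a k
    by (rule trig_polys_integrable[OF assms trig_polys_cis])
  have cis: "cis (2 * pi * real_of_int (k - j) * x)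
      = cnj (cis (2 * pi * real_of_int j * x)) * cis (2 * pi * real_of_int k * x)" for j k x
    by (simp add: cis_cnj cis_mult algebra_simps)
  have "cnj (trig c F x) * trig d G x
      = (\<Sum>j\<in>F. \<Sum>k\<in>G. cnj (c j) * d k * cis (2 * pi * real_of_int (k - j) * x))" for x
    unfolding trig_def cnj_sum sum_product cis
    by (intro sum.cong refl) (simp only: complex_cnj_mult mult_ac)
  then have "(LINT x|M. cnj (trig c F x) * trig d G x)
      = (LINT x|M. (\<Sum>j\<in>F. \<Sum>k\<in>G. cnj (c j) * d k * cis (2 * pi * real_of_int (k - j) * x)))"
    by (simp only:)
  also have "\<dots> = (\<Sum>j\<in>F. \<Sum>k\<in>G. (LINT x|M. cnj (c j) * d k * cis (2 * pi * real_of_int (k - j) * x)))"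
    by (simp only: Bochner_Integration.integral_sum Bochner_Integration.integrable_sum int)
  also have "\<dots> = (\<Sum>j\<in>F. \<Sum>k\<in>G. cnj (c j) * d k * (LINT x|M. cis (2 * pi * real_of_int (k - j) * x)))"
    by (simp only: integral_mult_right_zero)
  finally show ?thesis .
qed

text \<open>Polynomials are bounded, hence square integrable for a finite measure, so a complex
  Bochner identity can be read as one between extended nonnegative integrals.\<close>

lemma nn_integral_norm_square:
  assumes "sets M = sets lebesgue_01" "finite_measure M" "P \<in> trig_polys"
    and "(LINT x|M. cnj (P x) * P x) = complex_of_real r"
  shows "(\<integral>\<^sup>+x. ennreal ((cmod (P x))\<^sup>2) \<partial>M) = ennreal r"
proof -
  obtain C where C: "\<And>x. cmod (P x) \<le> C"
    using trig_polys_bounded[OF assms(3)] by blast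
  have [measurable]: "P \<in> borel_measurable M"
    by (intro borel_measurable_01[OF assms(1)] trig_polys_measurable assms)
  have int: "integrable M (\<lambda>x. (cmod (P x))\<^sup>2)"
    by (intro finite_measure.integrable_const_bound[OF assms(2), of _ "C\<^sup>2"])
      (auto intro!: power_mono C)
  have "complex_of_real r = (LINT x|M. complex_of_real ((cmod (P x))\<^sup>2))"
    unfolding assms(4)[symmetric]
    by (intro Bochner_Integration.integral_cong refl) (simp add: complex_norm_square mult.commute del: of_real_power)
  also have "\<dots> = complex_of_real (LINT x|M. (cmod (P x))\<^sup>2)"
    by (rule integral_complex_of_real)
  finally have "r = (LINT x|M. (cmod (P x))\<^sup>2)"
    by (simp only: of_real_eq_iff)
  then show ?thesis
    using nn_integral_eq_integral[OF int] by simp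
qed

text \<open>Both sides expand sesquilinearly, and the coefficients agree because the Gram matrix of
  the orbit consists of the moments of \<open>\<mu>\<close>.\<close>

lemma spectral_inner:
  assumes T: "unitary T" and \<mu>: "is_spectral_measure T \<phi> \<mu>"
    and "trig_vec T \<phi> P v" "trig_vec T \<phi> Q w"
  shows "cinner v w = (LINT x|\<mu>. cnj (P x) * Q x)"
proof -
  obtain c F d G where *: "P = trig c F" "v = opvec T \<phi> c F" "Q = trig d G" "w = opvec T \<phi> d G"
    using assms by (auto simp: trig_vec_def)
  have moments: "cinner \<phi> (upow T k \<phi>) = (LINT x|\<mu>. cis (2 * pi * real_of_int k * x))" for k
    using \<mu> by (simp add: is_spectral_measure_def)
  have "cinner v w = (\<Sum>j\<in>F. \<Sum>k\<in>G. cnj (c j) * (d k * cinner (upow T j \<phi>) (upow T k \<phi>)))"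
    unfolding * opvec_def cinner_sum_left
    by (simp add: cinner_sum_right cinner_scaleC_left cinner_scaleC_right sum_distrib_left mult.left_commute)
  also have "\<dots> = (LINT x|\<mu>. cnj (P x) * Q x)"
    unfolding * cinner_upow_upow[OF T] moments
    using \<mu> by (subst integral_cnj_trig_mult_trig) (auto simp: is_spectral_measure_def mult.assoc)
  finally show ?thesis .
qed

text \<open>Applied to differences of polynomials, this turns \<open>L^2\<close> estimates into norm
  estimates for vectors.\<close>

lemma spectral_norm:
  assumes "unitary T" "is_spectral_measure T \<phi> \<mu>" "trig_vec T \<phi> P v"
  shows "(\<integral>\<^sup>+x. ennreal ((cmod (P x))\<^sup>2) \<partial>\<mu>) = ennreal ((norm v)\<^sup>2)"
proof (rule nn_integral_norm_square)
  show "(LINT x|\<mu>. cnj (P x) * P x) = complex_of_real ((norm v)\<^sup>2)"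
    using spectral_inner[OF assms assms(3)] by (simp add: cinner_self)
qed (use assms in \<open>auto simp: is_spectral_measure_def intro: trig_vec_trig_polys\<close>)

section \<open>Bessel sequences\<close>

text \<open>The sum of the two measures dominates both, so a single approximation with respect to
  \<open>S\<close> is good for each of them at once.\<close>

lemma sum_measure_exists:
  assumes sets: "sets N = sets M" and fin: "finite_measure M" "finite_measure N"
  obtains S where "sets S = sets M" "finite_measure S" "M \<le> S" "N \<le> S"
proof -
  define S where "S = measure_of (space M) (sets M) (\<lambda>X. emeasure M X + emeasure N X)"
  have setsS: "sets S = sets M" and spaceS: "space S = space M"
    by (simp_all add: S_def)
  have S: "emeasure S X = emeasure M X + emeasure N X" if "X \<in> sets M" for X
    unfolding S_def
  proof (rule emeasure_measure_of_sigma)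
    show "countably_additive (sets M) (\<lambda>X. emeasure M X + emeasure N X)"
    proof (rule countably_additiveI)
      fix A :: "nat \<Rightarrow> 'a set"
      assume A: "range A \<subseteq> sets M" "disjoint_family A"
      then show "(\<Sum>i. emeasure M (A i) + emeasure N (A i)) = emeasure M (\<Union>i. A i) + emeasure N (\<Union>i. A i)"
        using sets by (simp add: suminf_add[symmetric] suminf_emeasure)
    qed
  qed (use that in \<open>auto simp: positive_def sets.sigma_algebra_axioms\<close>)
  show ?thesis
  proof (rule that[OF setsS])
    show "finite_measure S"
      using fin finite_measure.emeasure_finite[of M] finite_measure.emeasure_finite[of N]
      by (intro finite_measureI) (simp add: spaceS S)
    show "M \<le> S"
      by (subst le_measure) (simp_all add: setsS S)
    show "N \<le> S"
      by (subst le_measure) (simp_all add: setsS sets S)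
  qed
qed

section \<open>Orthonormality of the characters for Lebesgue measure\<close>

lemma integral_cis_lebesgue_01:
  "(LINT x|lebesgue_01. cis (2 * pi * real_of_int k * x)) = (if k = 0 then 1 else 0)"
proof -
  have "(LINT x|lebesgue_01. cis (2 * pi * real_of_int k * x))
      = (LINT x|lborel. indicator {0..<1} x *\<^sub>R cis (2 * pi * real_of_int k * x))"
    by (simp add: lebesgue_01_def integral_restrict_space)
  \<comment> \<open>The fundamental theorem is applied on a closed interval; the added endpoint is a
    null set.\<close>
  also have "\<dots> = (LINT x|lborel. indicator {0..1} x *\<^sub>R cis (2 * pi * real_of_int k * x))"
  proof (rule integral_cong_AE)
    show "AE x in lborel. indicat_real {0..<1} x *\<^sub>R cis (2 * pi * real_of_int k * x)
        = indicat_real {0..1} x *\<^sub>R cis (2 * pi * real_of_int k * x)"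
      using AE_lborel_singleton[of "1::real"] by eventually_elim (auto simp: indicator_def)
  qed (auto simp: cis_conv_exp intro!: borel_measurable_scaleR borel_measurable_continuous_onI continuous_intros)
  also have "\<dots> = (if k = 0 then 1 else 0)"
  proof (cases "k = 0")
    case True
    then show ?thesis by simp
  next
    case False
    define a where "a = \<i> * complex_of_real (2 * pi * real_of_int k)"
    have a: "a \<noteq> 0"
      using False by (simp add: a_def)
    define F where "F x = exp (a * complex_of_real x) / a" for x
    have cis: "cis (2 * pi * real_of_int k * x) = exp (a * complex_of_real x)" for x
      by (simp add: a_def cis_conv_exp mult_ac)
    have "(LINT x|lborel. indicator {0..1} x *\<^sub>R cis (2 * pi * real_of_int k * x)) = F 1 - F 0"
    proof (rule integral_FTC_atLeastAtMost)
      show "(F has_vector_derivative cis (2 * pi * real_of_int k * x)) (at x within {0..1})" for x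
        unfolding F_def[abs_def] cis
        by (rule has_vector_derivative_real_field) (use a in \<open>auto intro!: derivative_eq_intros\<close>)
    qed (auto simp: cis_conv_exp intro!: continuous_intros)
    \<comment> \<open>The primitive takes equal values at 0 and 1 because \<open>k\<close> is an
      integer.\<close>
    also have "\<dots> = 0"
      using cis[of 1] cis_multiple_2pi[of "real_of_int k"] by (simp add: F_def)
    finally show ?thesis
      using False by simp
  qed
  finally show ?thesis .
qed

text \<open>Parseval's identity: orthonormality kills the off-diagonal terms.\<close>

lemma integral_trig_lebesgue_01:
  assumes "finite F"
  shows "(LINT x|lebesgue_01. cnj (trig c F x) * trig c F x) = complex_of_real (\<Sum>k\<in>F. (cmod (c k))\<^sup>2)"
proof -
  have "(LINT x|lebesgue_01. cnj (trig c F x) * trig c F x)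
      = (\<Sum>j\<in>F. \<Sum>k\<in>F. cnj (c j) * c k * (if k - j = 0 then 1 else 0))"
    by (simp only: integral_cnj_trig_mult_trig[OF refl finite_measure_lebesgue_01] integral_cis_lebesgue_01)
  also have "\<dots> = (\<Sum>j\<in>F. \<Sum>k\<in>F. if k = j then cnj (c j) * c k else 0)"
    by (intro sum.cong refl) simp
  also have "\<dots> = (\<Sum>j\<in>F. cnj (c j) * c j)"
    using assms by (intro sum.cong refl) simp
  also have "\<dots> = complex_of_real (\<Sum>k\<in>F. (cmod (c k))\<^sup>2)"
    unfolding of_real_sum by (intro sum.cong refl) (simp only: complex_norm_square mult.commute)
  finally show ?thesis .
qed

text \<open>The Bessel inequality is tested on \<open>f = P(T)\<psi>\<close> itself. Expanding one
  factor of \<open>cinner f f\<close> and applying Cauchy-Schwarz to the coefficient sum bounds the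
  fourth power of \<open>norm f\<close> by \<open>B * s\<close> times its square.\<close>

lemma bessel_trig_bound:
  assumes T: "unitary T" and \<mu>: "is_spectral_measure T \<psi> \<mu>" and "0 \<le> B"
    and bessel: "\<And>f. f \<in> cyclic_subspace T \<psi> \<Longrightarrow>
      (\<lambda>k::int. (cmod (cinner (upow T k \<psi>) f))\<^sup>2) summable_on UNIV \<and>
      (\<Sum>\<^sub>\<infinity>k::int. (cmod (cinner (upow T k \<psi>) f))\<^sup>2) \<le> B * (norm f)\<^sup>2"
    and P: "P \<in> trig_polys"
  shows "(\<integral>\<^sup>+x. ennreal ((cmod (P x))\<^sup>2) \<partial>\<mu>) \<le> ennreal B * (\<integral>\<^sup>+x. ennreal ((cmod (P x))\<^sup>2) \<partial>lebesgue_01)"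
proof -
  obtain c F where *: "finite F" "P = trig c F"
    using P by (auto simp: trig_polys_def)
  define f where "f = opvec T \<psi> c F"
  have f: "trig_vec T \<psi> P f"
    using * unfolding trig_vec_def f_def by blast
  define s where "s = (\<Sum>k\<in>F. (cmod (c k))\<^sup>2)"
  have s: "0 \<le> s"
    by (simp add: s_def sum_nonneg)
  have b: "(\<Sum>k\<in>F. (cmod (cinner (upow T k \<psi>) f))\<^sup>2) \<le> B * (norm f)\<^sup>2"
    using bessel[OF trig_vec_in_cyclic[OF f]] *(1)
    by (intro order_trans[OF finite_sum_le_infsum]) auto
  have "(norm f)\<^sup>2 = cmod (cinner f f)"
    by (simp add: cinner_self norm_power)
  also have "cinner f f = (\<Sum>k\<in>F. cnj (c k) * cinner (upow T k \<psi>) f)"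
    by (subst (1) f_def) (simp add: opvec_def cinner_sum_left cinner_scaleC_left)
  also have "cmod \<dots> \<le> (\<Sum>k\<in>F. cmod (c k) * cmod (cinner (upow T k \<psi>) f))"
    by (rule sum_norm_le) (simp add: norm_mult)
  finally have "((norm f)\<^sup>2)\<^sup>2 \<le> (\<Sum>k\<in>F. cmod (c k) * cmod (cinner (upow T k \<psi>) f))\<^sup>2"
    by (rule power_mono) simp
  also have "\<dots> \<le> s * (\<Sum>k\<in>F. (cmod (cinner (upow T k \<psi>) f))\<^sup>2)"
    unfolding s_def by (rule Cauchy_Schwarz_ineq_sum)
  also have "\<dots> \<le> s * (B * (norm f)\<^sup>2)"
    using b s by (rule mult_left_mono)
  finally have "(norm f)\<^sup>2 * (norm f)\<^sup>2 \<le> (B * s) * (norm f)\<^sup>2"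
    by (simp add: power2_eq_square mult_ac)
  \<comment> \<open>Cancelling the common factor requires \<open>f\<close> to be nonzero; the zero
    vector is treated separately.\<close>
  then have "(norm f)\<^sup>2 \<le> B * s" if "f \<noteq> 0"
    by (rule mult_right_le_imp_le) (use that in simp)
  then have "(norm f)\<^sup>2 \<le> B * s"
    using s \<open>0 \<le> B\<close> by (cases "f = 0") auto
  moreover have "(\<integral>\<^sup>+x. ennreal ((cmod (P x))\<^sup>2) \<partial>lebesgue_01) = ennreal s"
    using nn_integral_norm_square[OF refl finite_measure_lebesgue_01 P] integral_trig_lebesgue_01[OF *(1), of c]
    by (simp only: * s_def)
  ultimately show ?thesis
    using s \<open>0 \<le> B\<close> by (simp add: spectral_norm[OF T \<mu> f] flip: ennreal_mult)
qed

text \<open>Let \<open>P\<close> be close to the indicator of a Lebesgue null set in both measures.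
  Then \<open>P\<close> is small for Lebesgue measure, by \<open>bound\<close> also for
  \<open>M\<close>, and therefore so is the indicator.\<close>

lemma absolutely_continuous_of_trig_bound:
  assumes M: "sets M = sets lebesgue_01" "finite_measure M" and "0 \<le> B"
    and bound: "\<And>P. P \<in> trig_polys \<Longrightarrow> (\<integral>\<^sup>+x. ennreal ((cmod (P x))\<^sup>2) \<partial>M)
        \<le> ennreal B * (\<integral>\<^sup>+x. ennreal ((cmod (P x))\<^sup>2) \<partial>lebesgue_01)"
  shows "absolutely_continuous lebesgue_01 M"
  unfolding absolutely_continuous_def
proof
  fix A assume A: "A \<in> null_sets lebesgue_01"
  then have setsA [measurable]: "A \<in> sets lebesgue_01" and setsA' [measurable]: "A \<in> sets M"
    using M by auto
  obtain S where S: "sets S = sets M" "finite_measure S" "M \<le> S" "lebesgue_01 \<le> S"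
    using sum_measure_exists[OF M(1)[symmetric] M(2) finite_measure_lebesgue_01] by blast
  have ind: "(\<integral>\<^sup>+x. ennreal ((cmod (indicator A x))\<^sup>2) \<partial>N) = emeasure N A" if "A \<in> sets N" for N :: "real measure"
  proof -
    have "(\<integral>\<^sup>+x. ennreal ((cmod (indicator A x))\<^sup>2) \<partial>N) = (\<integral>\<^sup>+x. indicator A x \<partial>N)"
      by (intro nn_integral_cong) (simp add: indicator_def)
    with that show ?thesis by simp
  qed
  have "emeasure M A \<le> ennreal e" if e: "0 < e" for e
  proof -
    \<comment> \<open>Solves \<open>2 * d + 2 * (B * (2 * d)) = e\<close>, the total of the two
      squared triangle inequalities below.\<close>
    define d where "d = e / (2 + 4 * B)"
    have d: "0 < d"
      using e \<open>0 \<le> B\<close> by (simp add: d_def)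
    have "trig_approx S (indicator A)"
      using setsA' S M by (intro trig_approx_indicator) auto
    then obtain P where P: "P \<in> trig_polys"
        "(\<integral>\<^sup>+x. ennreal ((cmod (indicator A x - P x))\<^sup>2) \<partial>S) \<le> ennreal d"
      using d by (rule trig_approxE)
    have near: "(\<integral>\<^sup>+x. ennreal ((cmod (indicator A x - P x))\<^sup>2) \<partial>N) \<le> ennreal d"
      if "sets N = sets S" "N \<le> S" for N
      using nn_integral_mono_measure[OF that] P(2) by (rule order_trans)
    have [measurable]: "P \<in> borel_measurable lebesgue_01" "P \<in> borel_measurable M"
      using P M by (auto intro!: borel_measurable_01 trig_polys_measurable)
    have "(\<integral>\<^sup>+x. ennreal ((cmod (P x - 0))\<^sup>2) \<partial>lebesgue_01) \<le> ennreal (2 * d + 2 * 0)"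
    proof (rule nn_integral_square_triangle[where g = "indicator A"])
      show "(\<integral>\<^sup>+x. ennreal ((cmod (P x - indicator A x))\<^sup>2) \<partial>lebesgue_01) \<le> ennreal d"
        using near[of lebesgue_01] S M by (simp add: norm_minus_commute)
      show "(\<integral>\<^sup>+x. ennreal ((cmod (indicator A x - 0))\<^sup>2) \<partial>lebesgue_01) \<le> ennreal 0"
        using A by (simp add: ind null_setsD1)
    qed (use d in auto)
    then have "(\<integral>\<^sup>+x. ennreal ((cmod (P x))\<^sup>2) \<partial>lebesgue_01) \<le> ennreal (2 * d)"
      by simp
    then have "ennreal B * (\<integral>\<^sup>+x. ennreal ((cmod (P x))\<^sup>2) \<partial>lebesgue_01) \<le> ennreal B * ennreal (2 * d)"
      by (rule mult_left_mono) simp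
    with bound[OF P(1)] have "(\<integral>\<^sup>+x. ennreal ((cmod (P x))\<^sup>2) \<partial>M) \<le> ennreal B * ennreal (2 * d)"
      by (rule order_trans)
    also have "\<dots> = ennreal (B * (2 * d))"
      using d \<open>0 \<le> B\<close> by (simp add: ennreal_mult)
    finally have P_small: "(\<integral>\<^sup>+x. ennreal ((cmod (P x))\<^sup>2) \<partial>M) \<le> ennreal (B * (2 * d))" .
    have "(\<integral>\<^sup>+x. ennreal ((cmod (indicator A x - 0))\<^sup>2) \<partial>M) \<le> ennreal (2 * d + 2 * (B * (2 * d)))"
      by (rule nn_integral_square_triangle[where g = P])
        (use near[of M] S P_small d \<open>0 \<le> B\<close> in auto)
    also have "2 * d + 2 * (B * (2 * d)) = d * (2 + 4 * B)"
      by (simp add: algebra_simps)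
    also have "\<dots> = e"
      using \<open>0 \<le> B\<close> by (simp add: d_def)
    finally show ?thesis
      by (simp add: ind)
  qed
  then have "emeasure M A \<le> 0"
    by (intro ennreal_le_epsilon[where y = 0, unfolded add_0_left])
  then show "A \<in> null_sets M"
    using setsA' by auto
qed

theorem bessel_density:
  assumes T: "unitary T" and \<mu>: "is_spectral_measure T \<psi> \<mu>" and "0 \<le> B"
    and bessel: "\<And>f. f \<in> cyclic_subspace T \<psi> \<Longrightarrow>
      (\<lambda>k::int. (cmod (cinner (upow T k \<psi>) f))\<^sup>2) summable_on UNIV \<and>
      (\<Sum>\<^sub>\<infinity>k::int. (cmod (cinner (upow T k \<psi>) f))\<^sup>2) \<le> B * (norm f)\<^sup>2"
  shows "\<exists>p::real \<Rightarrow> real. (\<forall>x. 0 \<le> p x) \<and> integrable lebesgue_01 p \<and>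
      \<mu> = density lebesgue_01 (\<lambda>x. ennreal (p x))"
proof -
  have M: "sets \<mu> = sets lebesgue_01" "finite_measure \<mu>"
    using \<mu> by (auto simp: is_spectral_measure_def)
  interpret L: finite_measure lebesgue_01
    by (rule finite_measure_lebesgue_01)
  have ac: "absolutely_continuous lebesgue_01 \<mu>"
    by (rule absolutely_continuous_of_trig_bound[OF M \<open>0 \<le> B\<close>])
      (rule bessel_trig_bound[OF T \<mu> \<open>0 \<le> B\<close> bessel])
  \<comment> \<open>Finiteness of the measures permits a real-valued version of the derivative; its
    integral is the total mass of \<open>\<mu>\<close>, hence finite.\<close>
  obtain D where D: "D \<in> borel_measurable lebesgue_01"
      "AE x in lebesgue_01. RN_deriv lebesgue_01 \<mu> x = ennreal (D x)" "\<And>x. 0 \<le> D x"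
    using L.real_RN_deriv[OF M(2) ac M(1)] by metis
  have "\<mu> = density lebesgue_01 (RN_deriv lebesgue_01 \<mu>)"
    using L.density_RN_deriv[OF ac M(1)] by simp
  also have "\<dots> = density lebesgue_01 (\<lambda>x. ennreal (D x))"
    using D by (intro density_cong) auto
  finally have dens: "\<mu> = density lebesgue_01 (\<lambda>x. ennreal (D x))" .
  have "(\<integral>\<^sup>+x. ennreal (D x) \<partial>lebesgue_01)
      = (\<integral>\<^sup>+x. ennreal (D x) * indicator (space lebesgue_01) x \<partial>lebesgue_01)"
    by (rule nn_integral_cong) simp
  also have "\<dots> = emeasure \<mu> (space lebesgue_01)"
    unfolding dens
    by (rule emeasure_density[OF measurable_compose[OF D(1) measurable_ennreal] sets.top, symmetric])
  also have "\<dots> < \<infinity>"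
    using finite_measure.emeasure_finite[OF M(2)] by (simp add: less_top)
  finally have "integrable lebesgue_01 D"
    using D by (intro integrableI_nonneg) auto
  then show ?thesis
    using D(3) dens by (intro exI[of _ D] conjI allI)
qed

section \<open>Renormalization\<close>

text \<open>Factor the difference of squares and split the mixed term by the weighted inequality
  between arithmetic and geometric mean. The free weight \<open>t\<close> replaces Cauchy-Schwarz
  for integrals in the limit argument.\<close>

lemma abs_diff_norm_squares_le:
  fixes a b :: complex
  assumes "0 < t"
  shows "\<bar>(cmod a)\<^sup>2 - (cmod b)\<^sup>2\<bar> \<le> (1 + inverse t) * (cmod (b - a))\<^sup>2 + t * (cmod b)\<^sup>2"
proof -
  define d where "d = cmod (b - a)"
  have d: "\<bar>cmod a - cmod b\<bar> \<le> d" "0 \<le> d"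
    using norm_triangle_ineq3[of a b] by (simp_all add: d_def norm_minus_commute)
  have "\<bar>(cmod a)\<^sup>2 - (cmod b)\<^sup>2\<bar> = \<bar>cmod a - cmod b\<bar> * (cmod a + cmod b)"
    by (simp add: power2_eq_square square_diff_square_factored abs_mult mult.commute)
  also have "\<dots> \<le> d * (d + 2 * cmod b)"
    using d by (intro mult_mono) auto
  also have "\<dots> \<le> (1 + inverse t) * d\<^sup>2 + t * (cmod b)\<^sup>2"
  proof -
    have "0 \<le> inverse t * (d - t * cmod b)\<^sup>2"
      using assms by simp
    also have "\<dots> = inverse t * d\<^sup>2 - 2 * (d * cmod b) + t * (cmod b)\<^sup>2"
      using assms by (simp add: power2_eq_square field_simps)
    finally show ?thesis
      by (simp add: algebra_simps power2_eq_square)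
  qed
  finally show ?thesis
    by (simp only: d_def)
qed

text \<open>\<open>L^2\<close> convergence of \<open>P n\<close> to \<open>f\<close> forces
  \<open>L^1\<close> convergence of the squared moduli. The bounded factor \<open>e\<close> will be
  a character, so that moments pass to the limit.\<close>

lemma tendsto_integral_norm_square:
  fixes f :: "'b \<Rightarrow> complex" and u :: "nat \<Rightarrow> real"
  assumes [measurable]: "f \<in> borel_measurable M" "\<And>n. P n \<in> borel_measurable M" "e \<in> borel_measurable M"
    and e: "\<And>x. cmod (e x) \<le> 1"
    and L2: "(\<integral>\<^sup>+x. ennreal ((cmod (f x))\<^sup>2) \<partial>M) < \<infinity>"
    and lim: "\<And>n. (\<integral>\<^sup>+x. ennreal ((cmod (f x - P n x))\<^sup>2) \<partial>M) \<le> ennreal ((u n)\<^sup>2)"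
    and u: "\<And>n. 0 < u n" "u \<longlonglongrightarrow> 0"
  shows "(\<lambda>n. LINT x|M. e x * complex_of_real ((cmod (P n x))\<^sup>2)) \<longlonglongrightarrow> (LINT x|M. e x * complex_of_real ((cmod (f x))\<^sup>2))"
proof -
  have int_f: "integrable M (\<lambda>x. (cmod (f x))\<^sup>2)"
    using L2 by (intro integrableI_nonneg) auto
  have int_d: "integrable M (\<lambda>x. (cmod (f x - P n x))\<^sup>2)" for n
    using le_less_trans[OF lim[of n] ennreal_less_top] by (intro integrableI_nonneg) auto
  have int_P: "integrable M (\<lambda>x. (cmod (P n x))\<^sup>2)" for n
  proof (rule Bochner_Integration.integrable_bound)
    show "integrable M (\<lambda>x. 2 * (cmod (f x - P n x))\<^sup>2 + 2 * (cmod (f x))\<^sup>2)"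
      by (intro Bochner_Integration.integrable_add integrable_mult_right int_d int_f)
    show "AE x in M. norm ((cmod (P n x))\<^sup>2) \<le> norm (2 * (cmod (f x - P n x))\<^sup>2 + 2 * (cmod (f x))\<^sup>2)"
    proof (rule AE_I2)
      fix x
      show "norm ((cmod (P n x))\<^sup>2) \<le> norm (2 * (cmod (f x - P n x))\<^sup>2 + 2 * (cmod (f x))\<^sup>2)"
        using norm_diff_square_le[of "P n x" 0 "f x"] by (simp add: norm_minus_commute)
    qed
  qed simp
  have int_e: "integrable M (\<lambda>x. e x * complex_of_real (g x))"
    if g [measurable]: "integrable M g" for g :: "'b \<Rightarrow> real"
  proof (rule Bochner_Integration.integrable_bound[OF g])
    show "AE x in M. norm (e x * complex_of_real (g x)) \<le> norm (g x)"
      using e by (intro AE_I2) (auto simp: norm_mult intro: mult_left_le_one_le)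
  qed simp
  define C where "C = (LINT x|M. (cmod (f x))\<^sup>2)"
  have bound: "cmod ((LINT x|M. e x * complex_of_real ((cmod (P n x))\<^sup>2))
      - (LINT x|M. e x * complex_of_real ((cmod (f x))\<^sup>2))) \<le> (u n)\<^sup>2 + u n + u n * C" for n
  proof -
    have "ennreal (LINT x|M. (cmod (f x - P n x))\<^sup>2) \<le> ennreal ((u n)\<^sup>2)"
      using lim[of n] nn_integral_eq_integral[OF int_d[of n]] by simp
    then have small: "(LINT x|M. (cmod (f x - P n x))\<^sup>2) \<le> (u n)\<^sup>2"
      by (simp add: ennreal_le_iff)
    have "(LINT x|M. e x * complex_of_real ((cmod (P n x))\<^sup>2)) - (LINT x|M. e x * complex_of_real ((cmod (f x))\<^sup>2))
        = (LINT x|M. e x * complex_of_real ((cmod (P n x))\<^sup>2) - e x * complex_of_real ((cmod (f x))\<^sup>2))"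
      by (rule Bochner_Integration.integral_diff[OF int_e[OF int_P] int_e[OF int_f], symmetric])
    \<comment> \<open>The weight is the error rate \<open>u n\<close> itself: its inverse is
      absorbed by the squared error \<open>(u n)\<^sup>2\<close>, so every term tends to 0.\<close>
    also have "cmod \<dots> \<le> (LINT x|M. (1 + inverse (u n)) * (cmod (f x - P n x))\<^sup>2 + u n * (cmod (f x))\<^sup>2)"
    proof (rule order_trans[OF integral_norm_bound integral_mono])
      show "integrable M (\<lambda>x. norm (e x * complex_of_real ((cmod (P n x))\<^sup>2) - e x * complex_of_real ((cmod (f x))\<^sup>2)))"
        by (intro integrable_norm Bochner_Integration.integrable_diff int_e int_P int_f)
      show "integrable M (\<lambda>x. (1 + inverse (u n)) * (cmod (f x - P n x))\<^sup>2 + u n * (cmod (f x))\<^sup>2)"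
        by (intro Bochner_Integration.integrable_add integrable_mult_right int_d int_f)
      fix x
      have "e x * complex_of_real ((cmod (P n x))\<^sup>2) - e x * complex_of_real ((cmod (f x))\<^sup>2)
          = e x * complex_of_real ((cmod (P n x))\<^sup>2 - (cmod (f x))\<^sup>2)"
        by (simp only: of_real_diff right_diff_distrib)
      then have "norm (e x * complex_of_real ((cmod (P n x))\<^sup>2) - e x * complex_of_real ((cmod (f x))\<^sup>2))
          = cmod (e x) * \<bar>(cmod (P n x))\<^sup>2 - (cmod (f x))\<^sup>2\<bar>"
        by (simp only: norm_mult norm_of_real)
      also have "\<dots> \<le> \<bar>(cmod (P n x))\<^sup>2 - (cmod (f x))\<^sup>2\<bar>"
        using e[of x] by (intro mult_left_le_one_le) auto
      also have "\<dots> \<le> (1 + inverse (u n)) * (cmod (f x - P n x))\<^sup>2 + u n * (cmod (f x))\<^sup>2"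
        by (rule abs_diff_norm_squares_le[OF u(1)])
      finally show "norm (e x * complex_of_real ((cmod (P n x))\<^sup>2) - e x * complex_of_real ((cmod (f x))\<^sup>2))
          \<le> (1 + inverse (u n)) * (cmod (f x - P n x))\<^sup>2 + u n * (cmod (f x))\<^sup>2" .
    qed
    also have "\<dots> = (1 + inverse (u n)) * (LINT x|M. (cmod (f x - P n x))\<^sup>2) + u n * C"
      by (simp add: C_def int_d int_f)
    also have "\<dots> \<le> (1 + inverse (u n)) * (u n)\<^sup>2 + u n * C"
      using small u(1)[of n] by (intro add_right_mono mult_left_mono) auto
    also have "\<dots> = (u n)\<^sup>2 + u n + u n * C"
      using u(1)[of n] by (simp add: power2_eq_square field_simps)
    finally show ?thesis .
  qed
  have "(\<lambda>n. (u n)\<^sup>2 + u n + u n * C) \<longlonglongrightarrow> 0\<^sup>2 + 0 + 0 * C"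
    by (intro tendsto_intros u(2))
  then have "(\<lambda>n. (u n)\<^sup>2 + u n + u n * C) \<longlonglongrightarrow> 0"
    by simp
  then have "(\<lambda>n. (LINT x|M. e x * complex_of_real ((cmod (P n x))\<^sup>2))
      - (LINT x|M. e x * complex_of_real ((cmod (f x))\<^sup>2))) \<longlonglongrightarrow> 0"
    by (rule Lim_null_comparison[OF always_eventually[OF allI[OF bound]]])
  then show ?thesis
    by (rule LIM_zero_cancel)
qed

theorem spectral_renormalization:
  fixes T :: "'a::chilbert_space \<Rightarrow> 'a"
  assumes T: "unitary T" and \<mu>: "is_spectral_measure T \<psi> \<mu>"
    and p0: "\<And>x. 0 \<le> p x" and p: "integrable lebesgue_01 p"
    and dens: "\<mu> = density lebesgue_01 (\<lambda>x. ennreal (p x))"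
    and A_def: "A = {x \<in> {0..<1}. 0 < p x}"
  shows "\<exists>v. cyclic_subspace T \<psi> = cyclic_subspace T v \<and>
      is_spectral_measure T v (density lebesgue_01 (\<lambda>x. ennreal (indicator A x)))"
proof -
  have M: "sets \<mu> = sets lebesgue_01" "finite_measure \<mu>"
    using \<mu> by (auto simp: is_spectral_measure_def)
  have mp [measurable]: "p \<in> borel_measurable lebesgue_01"
    using p by simp
  have meas_eq: "borel_measurable \<mu> = borel_measurable lebesgue_01"
    by (rule measurable_cong_sets[OF M(1) refl])
  have A [measurable]: "A \<in> sets lebesgue_01"
  proof -
    have "{x \<in> space lebesgue_01. 0 < p x} \<in> sets lebesgue_01"
      by measurable
    then show ?thesis
      by (simp add: A_def)
  qed
  have memA: "x \<in> A \<longleftrightarrow> 0 < p x" if "x \<in> space lebesgue_01" for x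
    using that by (simp add: A_def)
  have nn_\<mu>: "(\<integral>\<^sup>+x. g x \<partial>\<mu>) = (\<integral>\<^sup>+x. ennreal (p x) * g x \<partial>lebesgue_01)"
    if "g \<in> borel_measurable lebesgue_01" for g
    unfolding dens by (rule nn_integral_density) (use that in auto)
  define \<nu> where "\<nu> = density lebesgue_01 (\<lambda>x. ennreal (indicator A x))"
  have nn_\<nu>: "(\<integral>\<^sup>+x. g x \<partial>\<nu>) = (\<integral>\<^sup>+x. ennreal (indicator A x) * g x \<partial>lebesgue_01)"
    if "g \<in> borel_measurable lebesgue_01" for g
    unfolding \<nu>_def by (rule nn_integral_density) (use that in auto)
  have N: "sets \<nu> = sets lebesgue_01"
    by (simp add: \<nu>_def)
  have meas_eq': "borel_measurable \<nu> = borel_measurable lebesgue_01"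
    by (rule measurable_cong_sets[OF N refl])
  have "emeasure \<nu> (space \<nu>) = emeasure lebesgue_01 A"
  proof -
    have "emeasure \<nu> (space \<nu>) = (\<integral>\<^sup>+x. 1 \<partial>\<nu>)"
      by simp
    also have "\<dots> = (\<integral>\<^sup>+x. indicator A x \<partial>lebesgue_01)"
      by (subst nn_\<nu>, simp, simp only: ennreal_indicator mult_1_right)
    finally show ?thesis
      by simp
  qed
  then have finN: "finite_measure \<nu>"
    using finite_measure.emeasure_finite[OF finite_measure_lebesgue_01] by (intro finite_measureI) simp

  \<comment> \<open>Where \<open>p x = 0\<close> the junk value \<open>1 / 0 = 0\<close> makes \<open>f\<close> vanish.\<close>
  define f where "f x = complex_of_real (1 / sqrt (p x))" for x
  have f [measurable]: "f \<in> borel_measurable lebesgue_01"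
    unfolding f_def by measurable
  \<comment> \<open>This identity turns the measure with density \<open>(cmod (f x))\<^sup>2\<close>
    against \<open>\<mu>\<close> into Lebesgue measure on \<open>A\<close>.\<close>
  have pf: "p x * (cmod (f x))\<^sup>2 = indicator A x" if "x \<in> space lebesgue_01" for x
    using p0[of x] memA[OF that] by (cases "x \<in> A") (auto simp: f_def norm_divide power_divide)
  have "(\<integral>\<^sup>+x. ennreal ((cmod (f x))\<^sup>2) \<partial>\<mu>) = (\<integral>\<^sup>+x. ennreal (indicator A x) \<partial>lebesgue_01)"
    by (subst nn_\<mu>, simp, intro nn_integral_cong) (simp only: ennreal_mult[OF p0 zero_le_power2, symmetric] pf)
  also have "\<dots> = emeasure lebesgue_01 A"
    unfolding ennreal_indicator by (rule nn_integral_indicator[OF A])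
  also have "\<dots> < \<infinity>"
    using finite_measure.emeasure_finite[OF finite_measure_lebesgue_01] by (simp add: less_top)
  finally have fL2: "(\<integral>\<^sup>+x. ennreal ((cmod (f x))\<^sup>2) \<partial>\<mu>) < \<infinity>" .
  have approx: "trig_approx \<mu> f"
    by (rule trig_approx_L2[OF M _ fL2]) (simp add: meas_eq)

  \<comment> \<open>A positive null sequence fixing the approximation rate; it also serves as the
    weight in \<open>tendsto_integral_norm_square\<close>.\<close>
  define u where "u n = inverse (real (Suc n))" for n
  have u: "0 < u n" for n
    by (simp add: u_def)
  have u_lim: "u \<longlonglongrightarrow> 0"
    unfolding u_def by (rule LIMSEQ_inverse_real_of_nat)
  have "\<exists>P v. trig_vec T \<psi> P v \<and> (\<integral>\<^sup>+x. ennreal ((cmod (f x - P x))\<^sup>2) \<partial>\<mu>) \<le> ennreal ((u n)\<^sup>2)" for n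
  proof -
    obtain P where "P \<in> trig_polys" "(\<integral>\<^sup>+x. ennreal ((cmod (f x - P x))\<^sup>2) \<partial>\<mu>) \<le> ennreal ((u n)\<^sup>2)"
      by (rule trig_approxE[OF approx, of "(u n)\<^sup>2"]) (use u[of n] in auto)
    then show ?thesis
      by (meson trig_polys_vec)
  qed
  then obtain P s where Ps: "\<And>n. trig_vec T \<psi> (P n) (s n)"
      and P_lim: "\<And>n. (\<integral>\<^sup>+x. ennreal ((cmod (f x - P n x))\<^sup>2) \<partial>\<mu>) \<le> ennreal ((u n)\<^sup>2)"
    by metis
  have P_polys: "P n \<in> trig_polys" for n
    using Ps by (rule trig_vec_trig_polys)
  have P_meas [measurable]: "P n \<in> borel_measurable lebesgue_01" for n
    by (rule borel_measurable_01[OF refl trig_polys_measurable[OF P_polys]])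

  \<comment> \<open>By the isometry the distance of two vectors is the \<open>L^2\<close> distance
    of their polynomials, estimated through \<open>f\<close>.\<close>
  have dist_s: "(norm (s m - s n))\<^sup>2 \<le> 2 * (u m)\<^sup>2 + 2 * (u n)\<^sup>2" for m n
  proof -
    have "ennreal ((norm (s m - s n))\<^sup>2) = (\<integral>\<^sup>+x. ennreal ((cmod (P m x - P n x))\<^sup>2) \<partial>\<mu>)"
      by (rule spectral_norm[OF T \<mu> trig_vec_diff[OF T Ps Ps], symmetric])
    also have "\<dots> \<le> ennreal (2 * (u m)\<^sup>2 + 2 * (u n)\<^sup>2)"
      by (rule nn_integral_square_triangle[where g = f])
        (use P_lim in \<open>auto simp: meas_eq norm_minus_commute\<close>)
    finally show ?thesis
      by (subst (asm) ennreal_le_iff) auto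
  qed
  have "Cauchy s"
  proof (rule metric_CauchyI)
    fix e :: real assume e: "0 < e"
    then obtain k where k: "u k < e / 2"
      using order_tendstoD(2)[OF u_lim, of "e / 2"] by (auto simp: eventually_sequentially)
    have u_le: "(u m)\<^sup>2 \<le> (u k)\<^sup>2" if "k \<le> m" for m
      using that by (intro power_mono) (auto simp: u_def)
    have "dist (s m) (s n) < e" if "k \<le> m" "k \<le> n" for m n
    proof -
      have "(norm (s m - s n))\<^sup>2 \<le> (2 * u k)\<^sup>2"
        using dist_s[of m n] u_le[OF that(1)] u_le[OF that(2)] by (simp add: power_mult_distrib)
      then have "norm (s m - s n) \<le> 2 * u k"
        by (rule power2_le_imp_le) (use u[of k] in simp)
      then show ?thesis
        using k by (simp add: dist_norm)
    qed
    then show "\<exists>M. \<forall>m\<ge>M. \<forall>n\<ge>M. dist (s m) (s n) < e"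
      by blast
  qed
  \<comment> \<open>Completeness of the Hilbert space provides the renormalized vector.\<close>
  then obtain v where v: "s \<longlonglongrightarrow> v"
    using Cauchy_convergent[of s] by (auto simp: convergent_def)

  \<comment> \<open>The moments of \<open>v\<close> are limits of those of \<open>s n\<close>, which
    the isometry writes as integrals of a character against the squared modulus of
    \<open>P n\<close>.\<close>
  have spec_v: "is_spectral_measure T v \<nu>"
    unfolding is_spectral_measure_def
  proof (intro conjI allI N finN)
    fix k :: int
    let ?e = "\<lambda>x. cis (2 * pi * real_of_int k * x)"
    have [measurable]: "?e \<in> borel_measurable lebesgue_01"
      using borel_measurable_01[OF refl trig_polys_measurable[OF trig_polys_cis[of 1 k]]] by simp
    have "cinner (s n) (upow T k (s n)) = (LINT x|\<mu>. ?e x * complex_of_real ((cmod (P n x))\<^sup>2))" for n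
    proof -
      have "trig_vec T \<psi> (\<lambda>x. 1 * ?e x * P n x) (scaleC 1 (upow T k (s n)))"
        by (rule trig_vec_shift[OF T Ps])
      then have "cinner (s n) (scaleC 1 (upow T k (s n))) = (LINT x|\<mu>. cnj (P n x) * (1 * ?e x * P n x))"
        by (rule spectral_inner[OF T \<mu> Ps])
      moreover have "cnj (P n x) * (1 * ?e x * P n x) = ?e x * complex_of_real ((cmod (P n x))\<^sup>2)" for x
        by (simp only: complex_norm_square mult_1 mult_ac)
      ultimately show ?thesis
        by (simp only: scaleC_one)
    qed
    moreover have "(\<lambda>n. LINT x|\<mu>. ?e x * complex_of_real ((cmod (P n x))\<^sup>2))
        \<longlonglongrightarrow> (LINT x|\<mu>. ?e x * complex_of_real ((cmod (f x))\<^sup>2))"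
      by (rule tendsto_integral_norm_square[OF _ _ _ _ fL2 P_lim u u_lim]) (auto simp: meas_eq)
    moreover have "(\<lambda>n. cinner (s n) (upow T k (s n))) \<longlonglongrightarrow> cinner v (upow T k v)"
      by (intro tendsto_cinner unitary_tendsto[OF unitary_upow[OF T]] v)
    ultimately have "cinner v (upow T k v) = (LINT x|\<mu>. ?e x * complex_of_real ((cmod (f x))\<^sup>2))"
      using LIMSEQ_unique by (simp only:)
    also have "\<dots> = (LINT x|lebesgue_01. p x *\<^sub>R (?e x * complex_of_real ((cmod (f x))\<^sup>2)))"
      unfolding dens by (rule integral_density) (use p0 in auto)
    also have "\<dots> = (LINT x|lebesgue_01. indicator A x *\<^sub>R ?e x)"
    proof (rule Bochner_Integration.integral_cong[OF refl])
      fix x assume "x \<in> space lebesgue_01"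
      from pf[OF this] show "p x *\<^sub>R (?e x * complex_of_real ((cmod (f x))\<^sup>2)) = indicator A x *\<^sub>R ?e x"
        by (simp only: scaleR_conv_of_real mult.left_commute[of _ "?e x"] flip: of_real_mult) (simp only: mult.commute)
    qed
    also have "\<dots> = (LINT x|\<nu>. ?e x)"
      unfolding \<nu>_def by (rule integral_density[symmetric]) auto
    finally show "cinner v (upow T k v) = (LINT x|\<nu>. ?e x)" .
  qed

  have "s n \<in> cyclic_subspace T \<psi>" for n
    by (rule trig_vec_in_cyclic[OF Ps])
  then have v_in: "v \<in> cyclic_subspace T \<psi>"
    using v unfolding cyclic_subspace_def by (meson closed_closure closed_sequentially)

  have "\<psi> \<in> cyclic_subspace T v"
    unfolding cyclic_subspace_def cspan_orbit closure_approachable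
  proof (intro allI impI)
    fix e :: real assume e: "0 < e"
    \<comment> \<open>As \<open>n\<close> grows the squared distance is bounded by
      \<open>2 * d = e\<^sup>2 / 4\<close>, strictly below \<open>e\<^sup>2\<close>.\<close>
    define d where "d = e\<^sup>2 / 8"
    have d: "0 < d"
      using e by (simp add: d_def)
    \<comment> \<open>On \<open>A\<close> this is the reciprocal of \<open>f\<close>, so a
      polynomial near \<open>q\<close> undoes the renormalization.\<close>
    define q where "q x = complex_of_real (sqrt (p x))" for x
    have q [measurable]: "q \<in> borel_measurable lebesgue_01"
      unfolding q_def by measurable
    have "(\<integral>\<^sup>+x. ennreal ((cmod (q x))\<^sup>2) \<partial>\<nu>) \<le> (\<integral>\<^sup>+x. ennreal (p x) \<partial>lebesgue_01)"
      by (subst nn_\<nu>, simp, intro nn_integral_mono) (auto simp: q_def indicator_def p0)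
    also have "\<dots> < \<infinity>"
      using p p0 by (simp add: nn_integral_eq_integral)
    finally have "trig_approx \<nu> q"
      by (intro trig_approx_L2[OF N finN]) (simp_all add: meas_eq')
    then obtain Q where Q: "Q \<in> trig_polys" "(\<integral>\<^sup>+x. ennreal ((cmod (q x - Q x))\<^sup>2) \<partial>\<nu>) \<le> ennreal d"
      using d by (rule trig_approxE)
    have [measurable]: "Q \<in> borel_measurable lebesgue_01"
      by (rule borel_measurable_01[OF refl trig_polys_measurable[OF Q(1)]])
    obtain C where C: "\<And>x. cmod (Q x) \<le> C"
      using trig_polys_bounded[OF Q(1)] by blast
    have C0: "0 \<le> C"
      using norm_ge_zero C by (rule order_trans)
    obtain c F where cF: "finite F" "Q = trig c F"
      using Q(1) by (auto simp: trig_polys_def)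
    define w where "w = opvec T v c F"
    have w: "trig_vec T v Q w"
      using cF unfolding trig_vec_def w_def by blast

    have "(\<integral>\<^sup>+x. ennreal ((cmod (Q x * f x - 1))\<^sup>2) \<partial>\<mu>) = (\<integral>\<^sup>+x. ennreal ((cmod (q x - Q x))\<^sup>2) \<partial>\<nu>)"
    proof -
      \<comment> \<open>The factor \<open>sqrt (p x)\<close> is moved inside the modulus, where it
        cancels the denominator of \<open>f\<close>; outside \<open>A\<close> the density
        \<open>p\<close> vanishes.\<close>
      have "p x * (cmod (Q x * f x - 1))\<^sup>2 = indicator A x * (cmod (q x - Q x))\<^sup>2" if "x \<in> space lebesgue_01" for x
      proof (cases "x \<in> A")
        case True
        then have px: "0 < p x"
          using memA[OF that] by simp
        have "complex_of_real (sqrt (p x)) * (Q x * f x - 1) = Q x - q x"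
          using px by (simp add: f_def q_def field_simps)
        then have "cmod (complex_of_real (sqrt (p x)) * (Q x * f x - 1)) = cmod (q x - Q x)"
          by (simp only: norm_minus_commute)
        then have "sqrt (p x) * cmod (Q x * f x - 1) = cmod (q x - Q x)"
          using px by (simp add: norm_mult)
        then have "(sqrt (p x) * cmod (Q x * f x - 1))\<^sup>2 = (cmod (q x - Q x))\<^sup>2"
          by (simp only:)
        then show ?thesis
          using True px by (simp add: power_mult_distrib)
      next
        case False
        then show ?thesis
          using memA[OF that] p0[of x] by simp
      qed
      then show ?thesis
        by (subst nn_\<mu>, simp, subst nn_\<nu>, simp, intro nn_integral_cong)
          (simp add: p0 flip: ennreal_mult)
    qed
    then have Qf: "(\<integral>\<^sup>+x. ennreal ((cmod (Q x * f x - 1))\<^sup>2) \<partial>\<mu>) \<le> ennreal d"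
      using Q(2) by simp

    \<comment> \<open>Since \<open>Q(T)\<close> applied to \<open>s n\<close> is
      \<open>(Q P_n)(T)\<psi>\<close>, the isometry over \<open>\<mu>\<close> applies. The route
      from \<open>Q * P n\<close> to 1 passes through \<open>Q * f\<close>, with boundedness of
      \<open>Q\<close> controlling the first part.\<close>
    have bound: "(norm (opvec T (s n) c F - \<psi>))\<^sup>2 \<le> 2 * (C\<^sup>2 * (u n)\<^sup>2) + 2 * d" for n
    proof -
      have "(\<integral>\<^sup>+x. ennreal ((cmod (Q x * P n x - Q x * f x))\<^sup>2) \<partial>\<mu>)
          \<le> (\<integral>\<^sup>+x. ennreal (C\<^sup>2) * ennreal ((cmod (f x - P n x))\<^sup>2) \<partial>\<mu>)"
      proof (rule nn_integral_mono)
        fix x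
        have "(cmod (Q x * P n x - Q x * f x))\<^sup>2 = (cmod (Q x))\<^sup>2 * (cmod (f x - P n x))\<^sup>2"
          by (simp add: norm_mult power_mult_distrib norm_minus_commute flip: right_diff_distrib)
        also have "\<dots> \<le> C\<^sup>2 * (cmod (f x - P n x))\<^sup>2"
          by (intro mult_right_mono power_mono C) auto
        finally show "ennreal ((cmod (Q x * P n x - Q x * f x))\<^sup>2) \<le> ennreal (C\<^sup>2) * ennreal ((cmod (f x - P n x))\<^sup>2)"
          by (simp add: ennreal_leI flip: ennreal_mult)
      qed
      also have "\<dots> = ennreal (C\<^sup>2) * (\<integral>\<^sup>+x. ennreal ((cmod (f x - P n x))\<^sup>2) \<partial>\<mu>)"
        by (rule nn_integral_cmult) (simp add: meas_eq)
      also have "\<dots> \<le> ennreal (C\<^sup>2) * ennreal ((u n)\<^sup>2)"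
        by (intro mult_left_mono P_lim) simp
      also have "\<dots> = ennreal (C\<^sup>2 * (u n)\<^sup>2)"
        by (simp add: ennreal_mult)
      finally have QP: "(\<integral>\<^sup>+x. ennreal ((cmod (Q x * P n x - Q x * f x))\<^sup>2) \<partial>\<mu>) \<le> ennreal (C\<^sup>2 * (u n)\<^sup>2)" .
      have "trig_vec T \<psi> (\<lambda>x. Q x * P n x - 1) (opvec T (s n) c F - \<psi>)"
        unfolding cF(2) by (rule trig_vec_diff[OF T trig_vec_mult[OF T Ps] trig_vec_one])
      from spectral_norm[OF T \<mu> this]
      have "ennreal ((norm (opvec T (s n) c F - \<psi>))\<^sup>2) = (\<integral>\<^sup>+x. ennreal ((cmod (Q x * P n x - 1))\<^sup>2) \<partial>\<mu>)"
        by (rule sym)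
      also have "\<dots> \<le> ennreal (2 * (C\<^sup>2 * (u n)\<^sup>2) + 2 * d)"
        by (rule nn_integral_square_triangle[OF _ _ _ QP Qf]) (use d in \<open>auto simp: meas_eq\<close>)
      finally show ?thesis
        using d by (subst (asm) ennreal_le_iff) auto
    qed
    have "(norm (w - \<psi>))\<^sup>2 \<le> 2 * (C\<^sup>2 * 0\<^sup>2) + 2 * d"
    proof (rule LIMSEQ_le)
      show "(\<lambda>n. (norm (opvec T (s n) c F - \<psi>))\<^sup>2) \<longlonglongrightarrow> (norm (w - \<psi>))\<^sup>2"
        unfolding w_def by (intro tendsto_intros opvec_tendsto[OF T v])
      show "(\<lambda>n. 2 * (C\<^sup>2 * (u n)\<^sup>2) + 2 * d) \<longlonglongrightarrow> 2 * (C\<^sup>2 * 0\<^sup>2) + 2 * d"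
        by (intro tendsto_intros u_lim)
    qed (use bound in blast)
    also have "\<dots> < e\<^sup>2"
      using e by (simp add: d_def)
    finally have "dist w \<psi> < e"
      using e by (simp add: dist_norm power_less_imp_less_base)
    then show "\<exists>y\<in>{v'. \<exists>P. trig_vec T v P v'}. dist y \<psi> < e"
      using w by blast
  qed
  \<comment> \<open>Each vector lies in the cyclic subspace of the other, so monotonicity gives both
    inclusions.\<close>
  then have "cyclic_subspace T \<psi> = cyclic_subspace T v"
    using cyclic_subspace_mono[OF T] v_in by (intro equalityI)
  then show ?thesis
    using spec_v unfolding \<nu>_def by blast
qed

text \<open>An essential support is determined only up to null sets, so (c) takes the form of a null
  symmetric difference with the positivity set of \<open>p\<close>.\<close>

theorem theorem5p3:
  fixes T :: "'a::chilbert_space \<Rightarrow> 'a" and \<psi> :: 'a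
  assumes "unitary T" and "\<psi> \<noteq> 0"
  shows
    "((\<exists>B::real. B > 0 \<and>
         (\<forall>f \<in> cyclic_subspace T \<psi>.
            (\<lambda>k::int. (cmod (cinner (upow T k \<psi>) f))\<^sup>2) summable_on UNIV \<and>
            (\<Sum>\<^sub>\<infinity>k::int. (cmod (cinner (upow T k \<psi>) f))\<^sup>2) \<le> B * (norm f)\<^sup>2))
      \<longrightarrow> (\<forall>\<mu>. is_spectral_measure T \<psi> \<mu> \<longrightarrow>
             (\<exists>p::real \<Rightarrow> real. (\<forall>x. 0 \<le> p x) \<and> integrable lebesgue_01 p \<and>
                \<mu> = density lebesgue_01 (\<lambda>x. ennreal (p x)))))
   \<and>
     (\<forall>\<mu> (p::real \<Rightarrow> real).
        is_spectral_measure T \<psi> \<mu> \<and> (\<forall>x. 0 \<le> p x) \<and> integrable lebesgue_01 p \<and>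
        \<mu> = density lebesgue_01 (\<lambda>x. ennreal (p x))
      \<longrightarrow> (\<exists>\<psi>_REN A.
             A \<in> sets borel \<and> A \<subseteq> {0..1} \<and>
             cyclic_subspace T \<psi> = cyclic_subspace T \<psi>_REN \<and>
             is_spectral_measure T \<psi>_REN
               (density lebesgue_01 (\<lambda>x. ennreal (indicator A x))) \<and>
             emeasure lborel ((A - {x\<in>{0..<1}. 0 < p x}) \<union> ({x\<in>{0..<1}. 0 < p x} - A)) = 0))"
proof (rule conjI)
  show "(\<exists>B::real. B > 0 \<and>
         (\<forall>f \<in> cyclic_subspace T \<psi>.
            (\<lambda>k::int. (cmod (cinner (upow T k \<psi>) f))\<^sup>2) summable_on UNIV \<and>
            (\<Sum>\<^sub>\<infinity>k::int. (cmod (cinner (upow T k \<psi>) f))\<^sup>2) \<le> B * (norm f)\<^sup>2))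
      \<longrightarrow> (\<forall>\<mu>. is_spectral_measure T \<psi> \<mu> \<longrightarrow>
             (\<exists>p::real \<Rightarrow> real. (\<forall>x. 0 \<le> p x) \<and> integrable lebesgue_01 p \<and>
                \<mu> = density lebesgue_01 (\<lambda>x. ennreal (p x))))"
    (is "(\<exists>B. B > 0 \<and> (\<forall>f \<in> _. ?bessel B f)) \<longrightarrow> _")
  proof (intro impI allI, elim exE conjE)
    fix \<mu> B
    assume "is_spectral_measure T \<psi> \<mu>" "0 < B" "\<forall>f \<in> cyclic_subspace T \<psi>. ?bessel B f"
    then show "\<exists>p::real \<Rightarrow> real. (\<forall>x. 0 \<le> p x) \<and> integrable lebesgue_01 p \<and>
        \<mu> = density lebesgue_01 (\<lambda>x. ennreal (p x))"
      by (intro bessel_density[OF assms(1), of \<psi> \<mu> B]) auto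
  qed
next
  have "\<exists>\<psi>_REN A.
             A \<in> sets borel \<and> A \<subseteq> {0..1} \<and>
             cyclic_subspace T \<psi> = cyclic_subspace T \<psi>_REN \<and>
             is_spectral_measure T \<psi>_REN
               (density lebesgue_01 (\<lambda>x. ennreal (indicator A x))) \<and>
             emeasure lborel ((A - {x\<in>{0..<1}. 0 < p x}) \<union> ({x\<in>{0..<1}. 0 < p x} - A)) = 0"
    if \<mu>: "is_spectral_measure T \<psi> \<mu>" and p0: "\<forall>x. 0 \<le> p x" and p: "integrable lebesgue_01 p"
      and dens: "\<mu> = density lebesgue_01 (\<lambda>x. ennreal (p x))"
    for \<mu> and p :: "real \<Rightarrow> real"
  proof -
    \<comment> \<open>Choosing the positivity set of the given version of \<open>p\<close> makes the
      symmetric difference in (c) empty.\<close>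
    define A where "A = {x \<in> {0..<1}. 0 < p x}"
    obtain v where v: "cyclic_subspace T \<psi> = cyclic_subspace T v"
        "is_spectral_measure T v (density lebesgue_01 (\<lambda>x. ennreal (indicator A x)))"
      using spectral_renormalization[OF assms(1) \<mu> spec[OF p0] p dens A_def] by blast
    have "p \<in> borel_measurable lebesgue_01"
      using p by simp
    then have "{x \<in> space lebesgue_01. 0 < p x} \<in> sets lebesgue_01"
      by measurable
    then have "A \<in> sets borel" "A \<subseteq> {0..1}"
      by (auto simp: A_def sets_lebesgue_01_iff)
    with v show ?thesis
      by (intro exI[of _ v] exI[of _ A]) (simp add: A_def)
  qed
  then show "\<forall>\<mu> (p::real \<Rightarrow> real).
        is_spectral_measure T \<psi> \<mu> \<and> (\<forall>x. 0 \<le> p x) \<and> integrable lebesgue_01 p \<and>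
        \<mu> = density lebesgue_01 (\<lambda>x. ennreal (p x))
      \<longrightarrow> (\<exists>\<psi>_REN A.
             A \<in> sets borel \<and> A \<subseteq> {0..1} \<and>
             cyclic_subspace T \<psi> = cyclic_subspace T \<psi>_REN \<and>
             is_spectral_measure T \<psi>_REN
               (density lebesgue_01 (\<lambda>x. ennreal (indicator A x))) \<and>
             emeasure lborel ((A - {x\<in>{0..<1}. 0 < p x}) \<union> ({x\<in>{0..<1}. 0 < p x} - A)) = 0)"
    by blast
qed

end
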